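(* Let $A\subset\mathbb{R}^2$ be a finite two-dimensional set and let $B\subset\mathbb{R}^2$ be a two-dimensional set with $|B|=3$. Then there exist triangulations $T_A$ and $T_B$ of $[A]$ and $[B]$ using $A$ and $B$, respectively, as vertex sets, and a mixed subdivision $M$ of $[A+B]$ corresponding to $T_A$ and $T_B$, such that $$|M_{11}|\ \ge\ \sqrt{|T_A|\cdot|T_B|}.$$
   Context: $[X]$ denotes convex hull; a finite set in $\mathbb{R}^2$ is two-dimensional if it is not contained in a line. A triangulation $T_X$ of $X$ is a triangulation of $[X]$ using $X$ as the set of vertices; $|T_X|$ is its number of triangles. For finite two-dimensional $A,B$ with triangulations $T_A,T_B$, a mixed subdivision of $[A+B]$ corresponding to $T_A$ and $T_B$ is a polygonal subdivision $M$ of $[A+B]$ such that (i) every $k$-cell of $M$ is of the form $F+G$ where $F$ is an $i$-simplex of $T_A$ and $G$ is a $j$-simplex of $T_B$ with $i+j=k$; (ii) for any triangles $F$ of $T_A$ and $G$ of $T_B$ there is a unique $b\in B$ and a unique $a\in A$ such that $F+b\in M$ and $a+G\in M$. $M_{11}$ denotes the set of parallelograms of $M$, i.e. the 2-cells $F+G$ with $F$ an edge of $T_A$ and $G$ an edge of $T_B$. *)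

theory Defs
  imports "HOL-Analysis.Analysis"
begin

text \<open>The simplicial complexes of \<^const>\<open>simplicial_complex\<close> also contain the empty face, as the
  (-1)-simplex; this does not affect the vertices or the triangles.\<close>

definition triangulation_of :: "(real^2) set set \<Rightarrow> (real^2) set \<Rightarrow> bool" where
  "triangulation_of T X \<longleftrightarrow>
     simplicial_complex T \<and> \<Union>T = convex hull X \<and> {v. {v} \<in> T} = X"

definition triangles :: "(real^2) set set \<Rightarrow> (real^2) set set" where
  "triangles T = {F \<in> T. 2 simplex F}"

text \<open>Face-to-face subdivisions into convex polygons, given by all their nonempty cells.\<close>

definition polygonal_subdivision :: "(real^2) set set \<Rightarrow> (real^2) set \<Rightarrow> bool" where
  "polygonal_subdivision C P \<longleftrightarrow>
     finite C \<and> \<Union>C = P \<and>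
     (\<forall>K\<in>C. polytope K \<and> K \<noteq> {}) \<and>
     (\<forall>K\<in>C. \<forall>L. L face_of K \<and> L \<noteq> {} \<longrightarrow> L \<in> C) \<and>
     (\<forall>K\<in>C. \<forall>L\<in>C. (K \<inter> L) face_of K \<and> (K \<inter> L) face_of L)"

text \<open>Membership of a sum such as \<open>F + b\<close> in a mixed subdivision refers to the sum with its
  summands, not just to its set of points. With plain sets of points the uniqueness of \<open>b\<close> for
  \<open>F\<close> is not meaningful, because \<open>F + b = F' + b'\<close> can hold for different triangles
  \<open>F\<close>, \<open>F'\<close> (or \<open>F + b = a + G\<close>); for instance, two triples \<open>A = B\<close> would not
  have any mixed subdivision at all.
  A mixed subdivision is therefore a set of pairs \<open>(F, G)\<close>, each standing for the cell
  \<open>F + G\<close>; the injectivity condition says that every cell occurs with a single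
  decomposition.\<close>

definition mixed_subdivision ::
  "(real^2) set \<Rightarrow> (real^2) set \<Rightarrow> (real^2) set set \<Rightarrow> (real^2) set set
     \<Rightarrow> ((real^2) set \<times> (real^2) set) set \<Rightarrow> bool" where
  "mixed_subdivision A B TA TB M \<longleftrightarrow>
     polygonal_subdivision ((\<lambda>(F, G). F + G) ` M) (convex hull (A + B)) \<and>
     inj_on (\<lambda>(F, G). F + G) M \<and>
     (\<forall>(F, G) \<in> M. F \<in> TA \<and> G \<in> TB \<and>
        (\<exists>i j. i simplex F \<and> j simplex G \<and> aff_dim (F + G) = i + j)) \<and>
     (\<forall>F \<in> triangles TA. \<forall>G \<in> triangles TB.
        (\<exists>!b. b \<in> B \<and> (F, {b}) \<in> M) \<and> (\<exists>!a. a \<in> A \<and> ({a}, G) \<in> M))"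

definition parallelograms ::
  "((real^2) set \<times> (real^2) set) set \<Rightarrow> ((real^2) set \<times> (real^2) set) set" where
  "parallelograms M = {(F, G) \<in> M. 1 simplex F \<and> 1 simplex G \<and> aff_dim (F + G) = 2}"

end

theory Submission
  imports Defs
begin

text \<open>
  All subdivisions are regular: the cell of a functional \<open>c\<close> is the convex hull of the minimisers of
  \<open>\<lambda>p. h p - c \<bullet> p\<close>. Lift \<open>A\<close> by generic heights and \<open>B\<close> by \<open>0\<close>; pairing the cells of \<open>A\<close> and \<open>B\<close> for
  the same \<open>c\<close> gives \<open>M\<close>. Its parallelograms correspond to the edges met when \<open>c\<close> runs from \<open>0\<close> along the
  three outer normals \<open>N\<close> of the triangle \<open>[B]\<close>, that is, to the edges of three paths that start at the
  lowest lifted point of \<open>A\<close>.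

  Long paths come from peeling: repeatedly remove from \<open>A\<close> a face that is extreme in one of the three
  directions. Putting these faces back in reverse order, each lifted much higher than all earlier
  ones, makes each of them contribute an edge, so \<open>|M\<^sub>1\<^sub>1| \<ge> K - 1\<close> if \<open>K\<close> is the maximal number of peeling steps.

  On the other hand, a set that can be peeled at most \<open>K\<close> times has at most \<open>K (K + 1) / 2\<close> points, as
  each of its extreme faces has at most \<open>K\<close> points. Treating the last two faces with care improves
  this to \<open>2 |A| - m - 2 \<le> (K - 1)\<^sup>2\<close>, where \<open>m\<close> is the number of points on the three extreme faces,
  and any triangulation of \<open>A\<close> has at most \<open>2 |A| - m - 2\<close> triangles.
\<close>

section \<open>Regular subdivisions\<close>

text \<open>These points carry the face of the lower hull of the lifted points
  \<open>(p, h p)\<close> that has a supporting hyperplane of slope \<open>c\<close>. Many slopes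
  share a face; the redundant index matches cells of differently lifted sets.\<close>

definition lower :: "'a::euclidean_space set \<Rightarrow> ('a \<Rightarrow> real) \<Rightarrow> 'a \<Rightarrow> 'a set" where
  "lower P h c = {p \<in> P. \<forall>q\<in>P. h p - c \<bullet> p \<le> h q - c \<bullet> q}"

definition cell :: "'a::euclidean_space set \<Rightarrow> ('a \<Rightarrow> real) \<Rightarrow> 'a \<Rightarrow> 'a set" where
  "cell P h c = convex hull (lower P h c)"

lemma lower_subset: "lower P h c \<subseteq> P"
  by (auto simp: lower_def)

lemma finite_lower [simp]: "finite P \<Longrightarrow> finite (lower P h c)"
  by (rule finite_subset[OF lower_subset])

lemma lower_nonempty:
  assumes "finite P" "P \<noteq> {}"
  shows "lower P h c \<noteq> {}"
proof -
  have "Min ((\<lambda>p. h p - c \<bullet> p) ` P) \<in> (\<lambda>p. h p - c \<bullet> p) ` P"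
    using assms by (intro Min_in) auto
  then obtain p where p: "p \<in> P" "Min ((\<lambda>p. h p - c \<bullet> p) ` P) = h p - c \<bullet> p" by blast
  hence "p \<in> lower P h c"
    unfolding lower_def using assms Min_le[of "(\<lambda>p. h p - c \<bullet> p) ` P"] by auto
  thus ?thesis by blast
qed

lemma lowerD: "\<lbrakk>p \<in> lower P h c; q \<in> P\<rbrakk> \<Longrightarrow> h p - c \<bullet> p \<le> h q - c \<bullet> q"
  by (simp add: lower_def)

lemma lower_eq: "\<lbrakk>p \<in> lower P h c; q \<in> lower P h c\<rbrakk> \<Longrightarrow> h p - c \<bullet> p = h q - c \<bullet> q"
  by (auto simp: lower_def intro: antisym)

lemma lower_iff: "p \<in> lower P h c \<Longrightarrow> q \<in> P \<Longrightarrow> q \<in> lower P h c \<longleftrightarrow> h q - c \<bullet> q = h p - c \<bullet> p"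
  unfolding lower_def by (auto intro: antisym)

lemma finite_range_cell: "finite P \<Longrightarrow> finite (range (cell P h))"
proof (rule finite_subset)
  show "range (cell P h) \<subseteq> (\<lambda>X. convex hull X) ` Pow P"
    using lower_subset[of P h] unfolding cell_def by blast
qed auto

text \<open>Tilting the height function slightly refines the minimum lexicographically.\<close>

lemma lower_tilt:
  assumes "finite P" and Y: "Y = {p \<in> lower P h c. a \<bullet> p = b}" "Y \<noteq> {}"
    and le: "\<And>p. p \<in> lower P h c \<Longrightarrow> a \<bullet> p \<le> b"
  shows "\<exists>e. lower P h (c + e *\<^sub>R a) = Y"
proof -
  obtain y where y: "y \<in> Y" using Y by blast
  hence yX: "y \<in> lower P h c" and ya: "a \<bullet> y = b" using Y by auto
  have "\<forall>\<^sub>F e in at_right (0::real). h y - c \<bullet> y - e * (a \<bullet> y) < h q - c \<bullet> q - e * (a \<bullet> q)"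
    if q: "q \<in> P - lower P h c" for q
  proof -
    have "h y - c \<bullet> y < h q - c \<bullet> q"
      using q yX by (smt (verit) DiffD1 DiffD2 lowerD lower_iff)
    moreover have "((\<lambda>e. (h q - c \<bullet> q - e * (a \<bullet> q)) - (h y - c \<bullet> y - e * (a \<bullet> y))) \<longlongrightarrow>
        (h q - c \<bullet> q - 0 * (a \<bullet> q)) - (h y - c \<bullet> y - 0 * (a \<bullet> y))) (at_right (0::real))"
      by (intro tendsto_intros)
    ultimately have "\<forall>\<^sub>F e in at_right (0::real).
        0 < (h q - c \<bullet> q - e * (a \<bullet> q)) - (h y - c \<bullet> y - e * (a \<bullet> y))"
      by (intro order_tendstoD(1)[where y="h q - c \<bullet> q - (h y - c \<bullet> y)"]) auto
    thus ?thesis by eventually_elim simp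
  qed
  hence "\<forall>\<^sub>F e in at_right (0::real). \<forall>q\<in>P - lower P h c.
      h y - c \<bullet> y - e * (a \<bullet> y) < h q - c \<bullet> q - e * (a \<bullet> q)"
    using assms(1) by (intro eventually_ball_finite) auto
  moreover have "\<forall>\<^sub>F e in at_right (0::real). 0 < e"
    by (simp add: eventually_at_right_less)
  ultimately have "\<forall>\<^sub>F e in at_right (0::real). 0 < e \<and> (\<forall>q\<in>P - lower P h c.
      h y - c \<bullet> y - e * (a \<bullet> y) < h q - c \<bullet> q - e * (a \<bullet> q))"
    by eventually_elim simp
  then obtain e :: real where e: "0 < e" "\<And>q. q \<in> P - lower P h c \<Longrightarrow>
      h y - c \<bullet> y - e * (a \<bullet> y) < h q - c \<bullet> q - e * (a \<bullet> q)"
    using eventually_happens'[OF trivial_limit_at_right_real] by blast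
  have inY: "h q - c \<bullet> q - e * (a \<bullet> q) = h y - c \<bullet> y - e * (a \<bullet> y)" if "q \<in> Y" for q
    using that Y(1) y lower_eq[OF yX, of q] by auto
  have ge: "h y - c \<bullet> y - e * (a \<bullet> y) < h q - c \<bullet> q - e * (a \<bullet> q)" if q: "q \<in> P - Y" for q
  proof (cases "q \<in> lower P h c")
    case True
    hence "e * (a \<bullet> q) < e * (a \<bullet> y)" using le[OF True] q Y(1) ya e(1)
      by (intro mult_strict_left_mono) auto
    thus ?thesis using lower_eq[OF yX True] by linarith
  qed (use e(2) q in blast)
  have yP: "y \<in> P" using yX lower_subset by auto
  have YP: "Y \<subseteq> P" using Y(1) lower_subset by auto
  have "lower P h (c + e *\<^sub>R a) = Y"
  proof (intro subset_antisym subsetI)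
    fix p assume p: "p \<in> lower P h (c + e *\<^sub>R a)"
    show "p \<in> Y"
      using lowerD[OF p yP] ge[of p] lower_subset[of P h "c + e *\<^sub>R a"] p
      by (force simp: inner_add_left algebra_simps)
  next
    fix p assume p: "p \<in> Y"
    have "h p - (c + e *\<^sub>R a) \<bullet> p \<le> h q - (c + e *\<^sub>R a) \<bullet> q" if "q \<in> P" for q
      using inY[OF p] inY[of q] ge[of q] that by (cases "q \<in> Y") (auto simp: inner_add_left)
    thus "p \<in> lower P h (c + e *\<^sub>R a)" using p YP by (auto simp: lower_def)
  qed
  thus ?thesis by blast
qed

text \<open>A face of the hull of a finite set is spanned by points of that set, and here these have
  to lie on the hyperplane.\<close>

lemma face_of_convex_hull_supporting:
  fixes X :: "'a::euclidean_space set"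
  assumes "finite X" "L = convex hull X \<inter> {x. a \<bullet> x = b}" "\<And>x. x \<in> X \<Longrightarrow> a \<bullet> x \<le> b"
  shows "L face_of convex hull X" "L = convex hull {x \<in> X. a \<bullet> x = b}"
proof -
  have sub: "convex hull X \<subseteq> {x. a \<bullet> x \<le> b}"
    by (intro hull_minimal) (auto simp: assms convex_halfspace_le)
  show L: "L face_of convex hull X"
    unfolding assms(2)
    by (intro face_of_Int_supporting_hyperplane_le convex_convex_hull) (use sub in auto)
  obtain S' where S': "S' \<subseteq> X" "L = convex hull S'"
    by (rule face_of_convex_hull_subset[OF finite_imp_compact[OF assms(1)] L])
  have "S' \<subseteq> {x \<in> X. a \<bullet> x = b}"
    using S' assms(2) hull_subset[of S' convex] by auto
  hence "L \<subseteq> convex hull {x \<in> X. a \<bullet> x = b}"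
    using S' hull_mono by blast
  moreover have "convex hull {x \<in> X. a \<bullet> x = b} \<subseteq> L"
    unfolding assms(2) using hull_mono[of "{x \<in> X. a \<bullet> x = b}" X convex]
      hull_minimal[of "{x \<in> X. a \<bullet> x = b}" "{x. a \<bullet> x = b}" convex] convex_hyperplane
    by (auto simp del: hull_minimal)
  ultimately show "L = convex hull {x \<in> X. a \<bullet> x = b}" by blast
qed

text \<open>Faces of a polytope are exposed. By \<open>lower_tilt\<close>, adding a suitable
  multiple of the exposing functional to \<open>c\<close> selects exactly the generators on the
  face.\<close>

lemma face_of_cell:
  assumes "finite P" "L face_of cell P h c" "L \<noteq> {}"
  shows "L \<in> range (cell P h)"
proof -
  have "L exposed_face_of cell P h c"
    using assms by (simp add: cell_def exposed_face_of_polyhedron polyhedron_convex_hull)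
  then obtain a b where ab: "cell P h c \<subseteq> {x. a \<bullet> x \<le> b}" "L = cell P h c \<inter> {x. a \<bullet> x = b}"
    unfolding exposed_face_of_def by blast
  have le: "a \<bullet> p \<le> b" if "p \<in> lower P h c" for p
    using ab(1) that hull_subset[of "lower P h c" convex] unfolding cell_def by blast
  have L: "L = convex hull {x \<in> lower P h c. a \<bullet> x = b}"
    using assms ab le by (intro face_of_convex_hull_supporting) (auto simp: cell_def)
  hence "{x \<in> lower P h c. a \<bullet> x = b} \<noteq> {}" using assms(3) by auto
  from lower_tilt[OF assms(1) refl this le] L show ?thesis
    by (metis cell_def rangeI)
qed

text \<open>For each slope consider the highest affine function below the lifted points. On
  \<open>cell P h c\<close> the one for \<open>c\<close> is at least the one for \<open>c'\<close>,
  since it agrees with \<open>h\<close> on the generators.\<close>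

lemma lower_value_diff:
  assumes "p \<in> lower P h c" "q \<in> lower P h c'" "x \<in> cell P h c"
  shows "(c' - c) \<bullet> x \<le> (h p - c \<bullet> p) - (h q - c' \<bullet> q)"
proof -
  let ?k = "(h p - c \<bullet> p) - (h q - c' \<bullet> q)"
  have "cell P h c \<subseteq> {x. (c' - c) \<bullet> x \<le> ?k}"
    unfolding cell_def
  proof (intro hull_minimal convex_halfspace_le subsetI CollectI)
    fix y assume y: "y \<in> lower P h c"
    have "h q - c' \<bullet> q \<le> h y - c' \<bullet> y" using lowerD[OF assms(2)] y lower_subset by blast
    thus "(c' - c) \<bullet> y \<le> ?k" using lower_eq[OF assms(1) y] by (simp add: inner_diff_left)
  qed
  thus ?thesis using assms(3) by blast
qed

text \<open>The hyperplane is where the two supporting affine functions coincide. Common points of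
  both cells lie on it by \<open>lower_value_diff\<close>, and minimisers for \<open>c\<close> on it
  are also minimisers for \<open>c'\<close>.\<close>

lemma cell_Int_cell:
  assumes "finite P" "P \<noteq> {}"
  shows "(cell P h c \<inter> cell P h c') face_of cell P h c"
proof -
  obtain p q where p: "p \<in> lower P h c" and q: "q \<in> lower P h c'"
    using lower_nonempty[OF assms] by blast
  let ?k = "(h p - c \<bullet> p) - (h q - c' \<bullet> q)"
  let ?L = "convex hull (lower P h c) \<inter> {x. (c' - c) \<bullet> x = ?k}"
  have le: "(c' - c) \<bullet> x \<le> ?k" if "x \<in> lower P h c" for x
    using lower_value_diff[OF p q] that by (simp add: cell_def hull_inc)
  have L: "?L face_of convex hull (lower P h c)" "?L = convex hull {x \<in> lower P h c. (c' - c) \<bullet> x = ?k}"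
    using assms le by (intro face_of_convex_hull_supporting; auto)+
  have "{x \<in> lower P h c. (c' - c) \<bullet> x = ?k} \<subseteq> lower P h c'"
  proof clarify
    fix x assume x: "x \<in> lower P h c" "(c' - c) \<bullet> x = ?k"
    hence "h x - c' \<bullet> x = h q - c' \<bullet> q"
      using lower_eq[OF p x(1)] by (simp add: inner_diff_left)
    thus "x \<in> lower P h c'" using lower_iff[OF q] x lower_subset by blast
  qed
  hence "?L \<subseteq> cell P h c'" unfolding L(2) cell_def by (rule hull_mono)
  moreover have "cell P h c \<inter> cell P h c' \<subseteq> ?L"
    using lower_value_diff[OF p q] lower_value_diff[OF q p]
    by (force simp: cell_def inner_diff_left)
  ultimately have "cell P h c \<inter> cell P h c' = ?L" by (auto simp: cell_def)
  thus ?thesis using L(1) by (simp add: cell_def)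
qed

text \<open>The supporting functional of the lifted points below \<open>x\<close> maximises the concave
  function \<open>\<lambda>c. Min\<^sub>p (h p + c \<bullet> (x - p))\<close>, which is coercive since \<open>x\<close> is an interior point.\<close>

lemma interior_in_cell:
  assumes "finite P" "x \<in> interior (convex hull P)"
  shows "\<exists>c. x \<in> cell P h c"
proof -
  have ne: "P \<noteq> {}" using assms by auto
  define m where "m c = Min ((\<lambda>p. h p + c \<bullet> (x - p)) ` P)" for c
  obtain r where r: "r > 0" "cball x r \<subseteq> convex hull P"
    using assms(2) by (meson mem_interior_cball)
  \<comment> \<open>Otherwise \<open>P\<close> and its hull would lie in an open halfspace that
    misses the point of the ball farthest in direction \<open>c\<close>.\<close>
  have coercive: "\<exists>p\<in>P. c \<bullet> (x - p) \<le> - (r * norm c)" for c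
  proof (rule ccontr)
    assume "\<not> ?thesis"
    hence "P \<subseteq> {p. c \<bullet> p < c \<bullet> x + r * norm c}" by (auto simp: inner_diff_right not_le)
    hence sub: "convex hull P \<subseteq> {p. c \<bullet> p < c \<bullet> x + r * norm c}"
      by (intro hull_minimal convex_halfspace_lt)
    show False
    proof (cases "c = 0")
      case False
      have "x + (r / norm c) *\<^sub>R c \<in> cball x r" using r by (simp add: dist_norm)
      thus False using sub r(2) False by (force simp: inner_add_right power2_eq_square dot_square_norm)
    qed (use sub r in force)
  qed
  define H where "H = Max (h ` P)"
  have H: "h p \<le> H" if "p \<in> P" for p unfolding H_def using that assms by auto
  \<comment> \<open>Beyond this radius coercivity pushes \<open>m\<close> below \<open>m 0\<close>,
    so a maximum over the compact ball is a global one.\<close>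
  define R where "R = (H - m 0) / r"
  have "m 0 \<le> H"
  proof -
    obtain p where "p \<in> P" using ne by blast
    thus ?thesis using H[of p] assms(1) unfolding m_def
      by (intro order_trans[OF Min_le]) auto
  qed
  hence "R \<ge> 0" using r by (simp add: R_def)
  have cont: "continuous_on (cball 0 R) m"
  proof -
    have "continuous_on S (\<lambda>c. Min ((\<lambda>p. h p + c \<bullet> (x - p)) ` Q))"
      if "finite Q" "Q \<noteq> {}" for S :: "'a set" and Q
      using that by (induction rule: finite_ne_induct) (auto intro!: continuous_intros)
    thus ?thesis unfolding m_def using assms(1) ne by blast
  qed
  have "\<exists>c\<in>cball 0 R. \<forall>y\<in>cball 0 R. m y \<le> m c"
    by (rule continuous_attains_sup) (use cont \<open>R \<ge> 0\<close> in auto)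
  then obtain c where c: "c \<in> cball 0 R" "\<And>y. y \<in> cball 0 R \<Longrightarrow> m y \<le> m c" by blast
  have max: "m y \<le> m c" for y
  proof (cases "y \<in> cball 0 R")
    case False
    hence n: "norm y > R" by simp
    obtain p where p: "p \<in> P" "y \<bullet> (x - p) \<le> - (r * norm y)" using coercive by blast
    have "m y \<le> h p + y \<bullet> (x - p)" unfolding m_def using p assms by auto
    also have "\<dots> \<le> H - r * norm y" using H p by fastforce
    also have "\<dots> \<le> m 0"
      using n r(1) unfolding R_def by (simp add: pos_divide_less_eq algebra_simps)
    also have "\<dots> \<le> m c" using c(2)[of 0] \<open>R \<ge> 0\<close> by simp
    finally show ?thesis .
  qed (use c in blast)
  \<comment> \<open>A functional \<open>a\<close> separating \<open>x\<close> from the cell would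
    make \<open>- a\<close> a direction of ascent for \<open>m\<close>: it strictly raises the terms
    of the minimisers, and all other terms have room to spare.\<close>
  have "x \<in> cell P h c"
  proof (rule ccontr)
    assume "x \<notin> cell P h c"
    hence "\<exists>a b. a \<bullet> x < b \<and> (\<forall>p\<in>cell P h c. b < a \<bullet> p)"
      unfolding cell_def using assms(1)
      by (intro separating_hyperplane_closed_point)
        (auto simp: compact_imp_closed finite_imp_compact_convex_hull)
    then obtain a b where ab: "a \<bullet> x < b" "\<And>p. p \<in> cell P h c \<Longrightarrow> b < a \<bullet> p" by blast
    have pos: "a \<bullet> (x - p) < 0" if "p \<in> lower P h c" for p
      using ab(1) ab(2)[of p] that by (simp add: cell_def hull_inc inner_diff_right)
    have "\<forall>\<^sub>F e in at_right (0::real). m c < h q + (c - e *\<^sub>R a) \<bullet> (x - q)" if q: "q \<in> P" for q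
    proof (cases "q \<in> lower P h c")
      case True
      have "m c \<le> h q + c \<bullet> (x - q)" unfolding m_def using q assms by auto
      moreover have "\<forall>\<^sub>F e in at_right (0::real). 0 < e" by (simp add: eventually_at_right_less)
      ultimately show ?thesis
      proof (elim eventually_mono)
        fix e :: real assume "0 < e" "m c \<le> h q + c \<bullet> (x - q)"
        moreover have "e * (a \<bullet> (x - q)) < 0" using pos[OF True] \<open>0 < e\<close> by (simp add: mult_pos_neg)
        ultimately show "m c < h q + (c - e *\<^sub>R a) \<bullet> (x - q)" by (simp add: inner_diff_left)
      qed
    next
      case False
      then obtain p where p: "p \<in> P" "h p - c \<bullet> p < h q - c \<bullet> q"
        using q by (auto simp: lower_def not_le)
      have "m c \<le> h p + c \<bullet> (x - p)" unfolding m_def using p assms by auto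
      hence "m c < h q + c \<bullet> (x - q)" using p by (simp add: inner_diff_right)
      moreover have "((\<lambda>e. h q + (c - e *\<^sub>R a) \<bullet> (x - q)) \<longlongrightarrow> h q + (c - 0 *\<^sub>R a) \<bullet> (x - q))
          (at_right (0::real))" by (intro tendsto_intros)
      ultimately show ?thesis
        by (intro order_tendstoD(1)[where y="h q + c \<bullet> (x - q)"]) auto
    qed
    hence "\<forall>\<^sub>F e in at_right (0::real). \<forall>q\<in>P. m c < h q + (c - e *\<^sub>R a) \<bullet> (x - q)"
      using assms(1) by (intro eventually_ball_finite) auto
    then obtain e where "\<forall>q\<in>P. m c < h q + (c - e *\<^sub>R a) \<bullet> (x - q)"
      using eventually_happens'[OF trivial_limit_at_right_real] by blast
    hence "m c < m (c - e *\<^sub>R a)" unfolding m_def[of "c - e *\<^sub>R a"] using assms(1) ne by auto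
    thus False using max[of "c - e *\<^sub>R a"] by simp
  qed
  thus ?thesis by blast
qed

text \<open>The finitely many compact cells cover the interior, hence also its closure, which is the
  entire hull.\<close>

lemma Union_cells:
  assumes "finite P" "interior (convex hull P) \<noteq> {}"
  shows "\<Union>(range (cell P h)) = convex hull P"
proof
  show "\<Union>(range (cell P h)) \<subseteq> convex hull P"
    unfolding cell_def using hull_mono[OF lower_subset] by blast
  have "closed (\<Union>(range (cell P h)))"
    using finite_range_cell[OF assms(1)] assms(1)
    by (intro closed_Union) (auto simp: cell_def compact_imp_closed finite_imp_compact_convex_hull)
  moreover have "interior (convex hull P) \<subseteq> \<Union>(range (cell P h))"
    using interior_in_cell[OF assms(1)] by blast
  ultimately have "closure (interior (convex hull P)) \<subseteq> \<Union>(range (cell P h))"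
    by (simp add: closure_minimal)
  thus "convex hull P \<subseteq> \<Union>(range (cell P h))"
    using convex_closure_interior[OF convex_convex_hull assms(2)] closure_subset[of "convex hull P"]
    by simp
qed

section \<open>Regular subdivisions of Minkowski sums\<close>

text \<open>Lifting a Minkowski sum by the infimal convolution makes its cells the sums of the cells of the
  summands, so mixed subdivisions are regular subdivisions of \<open>A + B\<close>.\<close>

definition sum_height ::
  "'a::euclidean_space set \<Rightarrow> 'a set \<Rightarrow> ('a \<Rightarrow> real) \<Rightarrow> ('a \<Rightarrow> real) \<Rightarrow> 'a \<Rightarrow> real" where
  "sum_height A B f g s = Min ((\<lambda>(a, b). f a + g b) ` {(a, b) \<in> A \<times> B. a + b = s})"

lemma sum_height_le:
  assumes "finite A" "finite B" "a \<in> A" "b \<in> B"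
  shows "sum_height A B f g (a + b) \<le> f a + g b"
proof -
  have "finite {(a', b') \<in> A \<times> B. a' + b' = a + b}"
    by (rule finite_subset[of _ "A \<times> B"]) (use assms in auto)
  thus ?thesis unfolding sum_height_def using assms
    by (intro Min_le) (auto intro!: image_eqI[of _ _ "(a, b)"])
qed

lemma sum_height_attained:
  assumes "finite A" "finite B" "s \<in> A + B"
  obtains a b where "a \<in> A" "b \<in> B" "s = a + b" "sum_height A B f g s = f a + g b"
proof -
  let ?Z = "{(a, b) \<in> A \<times> B. a + b = s}"
  have "finite ?Z"
    by (rule finite_subset[of _ "A \<times> B"]) (use assms in auto)
  moreover have "?Z \<noteq> {}" using assms(3) by (auto elim!: set_plus_elim)
  ultimately have "sum_height A B f g s \<in> (\<lambda>(a, b). f a + g b) ` ?Z"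
    unfolding sum_height_def by (intro Min_in) auto
  thus thesis using that by auto
qed

text \<open>A point of \<open>A + B\<close> may have several decompositions. The equation on the
  left singles out those that attain the infimal convolution; for them minimality splits into two
  independent conditions.\<close>

lemma lower_sum_height_iff:
  assumes "finite A" "finite B" "a \<in> A" "b \<in> B"
  shows "a + b \<in> lower (A + B) (sum_height A B f g) c \<and> sum_height A B f g (a + b) = f a + g b
    \<longleftrightarrow> a \<in> lower A f c \<and> b \<in> lower B g c" (is "?l \<longleftrightarrow> ?r")
proof
  assume l: ?l
  have *: "f a + g b - c \<bullet> (a + b) \<le> f a' + g b' - c \<bullet> (a' + b')" if "a' \<in> A" "b' \<in> B" for a' b'
    using lowerD[of "a + b" "A + B" "sum_height A B f g" c "a' + b'"] l
      sum_height_le[OF assms(1,2) that, of f g] set_plus_intro[OF that] by linarith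
  show ?r using *[OF assms(3)] *[OF _ assms(4)] assms(3,4)
    by (auto simp: lower_def inner_add_right)
next
  assume r: ?r
  have le: "f a + g b - c \<bullet> (a + b) \<le> sum_height A B f g s - c \<bullet> s" if s: "s \<in> A + B" for s
  proof -
    obtain a' b' where "a' \<in> A" "b' \<in> B" "s = a' + b'" "sum_height A B f g s = f a' + g b'"
      using sum_height_attained[OF assms(1,2) s] by blast
    thus ?thesis using lowerD[of a A f c a'] lowerD[of b B g c b'] r
      by (simp add: inner_add_right)
  qed
  have ab: "a + b \<in> A + B" using assms(3,4) by (rule set_plus_intro)
  have eq: "sum_height A B f g (a + b) = f a + g b"
    using le[OF ab] sum_height_le[OF assms, of f g] by linarith
  thus ?l using le ab unfolding lower_def by simp
qed

lemma lower_sum_height: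
  assumes "finite A" "finite B"
  shows "lower (A + B) (sum_height A B f g) c = lower A f c + lower B g c"
proof (intro subset_antisym subsetI)
  fix s assume s: "s \<in> lower (A + B) (sum_height A B f g) c"
  then obtain a b where ab: "a \<in> A" "b \<in> B" "s = a + b" "sum_height A B f g s = f a + g b"
    using sum_height_attained[OF assms] lower_subset by blast
  thus "s \<in> lower A f c + lower B g c"
    using lower_sum_height_iff[OF assms ab(1,2), of f g c] s by (auto intro: set_plus_intro)
next
  fix s assume "s \<in> lower A f c + lower B g c"
  then obtain a b where ab: "a \<in> lower A f c" "b \<in> lower B g c" "s = a + b"
    by (auto elim: set_plus_elim)
  thus "s \<in> lower (A + B) (sum_height A B f g) c"
    using lower_sum_height_iff[OF assms, of a b f g c] lower_subset by blast
qed

lemma cell_sum_height: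
  assumes "finite A" "finite B"
  shows "cell (A + B) (sum_height A B f g) c = cell A f c + cell B g c"
  by (simp add: cell_def lower_sum_height[OF assms] convex_hull_set_plus)

text \<open>On a common cell the two supporting affine functions agree, by
  \<open>lower_value_diff\<close> in both directions. A cell may contain points of \<open>P\<close>
  that are lifted too high, so \<open>lower\<close> is not just its intersection with
  \<open>P\<close>.\<close>

lemma cell_eq_imp_lower_eq:
  assumes "finite P" "P \<noteq> {}" "cell P h c = cell P h c'"
  shows "lower P h c = lower P h c'"
proof -
  have *: "lower P h c \<subseteq> lower P h c'" if e: "cell P h c = cell P h c'" for c c'
  proof
    fix x assume x: "x \<in> lower P h c"
    obtain q where q: "q \<in> lower P h c'" using lower_nonempty[OF assms(1,2)] by blast
    have "x \<in> cell P h c" using x by (simp add: cell_def hull_inc)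
    from lower_value_diff[OF x q this] lower_value_diff[OF q x] this e
    have "h x - c' \<bullet> x = h q - c' \<bullet> q" by (force simp: inner_diff_left)
    thus "x \<in> lower P h c'" using lower_iff[OF q] x lower_subset by blast
  qed
  show ?thesis using *[of c c'] *[of c' c] assms(3) by auto
qed

text \<open>By \<open>lower_sum_height_iff\<close>, a pair of minimisers is recognised by its sum
  being minimal and by attaining \<open>sum_height\<close>. The first depends only on the cell of
  the sum, the second not on \<open>c\<close> at all.\<close>

lemma cell_sum_inj:
  assumes "finite A" "finite B" "A \<noteq> {}" "B \<noteq> {}"
    and eq: "cell A f c + cell B g c = cell A f c' + cell B g c'"
  shows "lower A f c = lower A f c' \<and> lower B g c = lower B g c'"
proof -
  let ?h = "sum_height A B f g"
  obtain a b where "a \<in> A" "b \<in> B" using assms(3,4) by blast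
  hence "a + b \<in> A + B" by (rule set_plus_intro)
  hence "A + B \<noteq> {}" by (metis emptyE)
  note AB = finite_set_plus[OF assms(1,2)] this
  have L: "lower (A + B) ?h c = lower (A + B) ?h c'"
    by (rule cell_eq_imp_lower_eq[OF AB], unfold cell_sum_height[OF assms(1,2)], rule eq)
  have *: "a \<in> lower A f c' \<and> b \<in> lower B g c'"
    if "a \<in> lower A f c" "b \<in> lower B g c" "lower (A + B) ?h c = lower (A + B) ?h c'" for a b c c'
  proof -
    have "a \<in> A" "b \<in> B" using that(1,2) by (simp_all add: lower_def)
    note iff = lower_sum_height_iff[OF assms(1,2) this]
    show ?thesis using iff[of f g c] iff[of f g c'] that by blast
  qed
  obtain a b where ab: "a \<in> lower A f c" "b \<in> lower B g c"
    using lower_nonempty[OF assms(1,3)] lower_nonempty[OF assms(2,4)] by blast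
  obtain a' b' where ab': "a' \<in> lower A f c'" "b' \<in> lower B g c'"
    using lower_nonempty[OF assms(1,3)] lower_nonempty[OF assms(2,4)] by blast
  show ?thesis
    using *[OF _ _ L] *[OF _ _ L[symmetric]] ab ab' by blast
qed

section \<open>Peeling a finite set in three directions\<close>

definition top_face :: "'a::euclidean_space \<Rightarrow> 'a set \<Rightarrow> 'a set" where
  "top_face u A = {p \<in> A. \<forall>q\<in>A. u \<bullet> q \<le> u \<bullet> p}"

lemma top_face_subset: "top_face u A \<subseteq> A"
  by (auto simp: top_face_def)

lemma finite_top_face [simp]: "finite A \<Longrightarrow> finite (top_face u A)"
  by (rule finite_subset[OF top_face_subset])

lemma top_face_eq: "\<lbrakk>p \<in> top_face u A; q \<in> top_face u A\<rbrakk> \<Longrightarrow> u \<bullet> p = u \<bullet> q"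
  by (auto simp: top_face_def intro: antisym)

lemma top_face_nonempty:
  assumes "finite A" "A \<noteq> {}"
  shows "top_face u A \<noteq> {}"
proof -
  have "Max ((\<bullet>) u ` A) \<in> (\<bullet>) u ` A" using assms by (intro Max_in) auto
  then obtain p where p: "p \<in> A" "Max ((\<bullet>) u ` A) = u \<bullet> p" by blast
  hence "p \<in> top_face u A" unfolding top_face_def using assms Max_ge[of "(\<bullet>) u ` A"] by auto
  thus ?thesis by blast
qed

text \<open>The direction is free at each step, so one set can have peelings of different lengths;
  \<open>depth\<close> is the largest.\<close>

inductive peel :: "'a::euclidean_space set \<Rightarrow> 'a set \<Rightarrow> nat \<Rightarrow> bool" for N where
  empty: "peel N {} 0"
| step: "\<lbrakk>A \<noteq> {}; u \<in> N; peel N (A - top_face u A) k\<rbrakk> \<Longrightarrow> peel N A (Suc k)"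

definition depth :: "'a::euclidean_space set \<Rightarrow> 'a set \<Rightarrow> nat" where
  "depth N A = Max {k. peel N A k}"

lemma card_Diff_top_face:
  assumes "finite A" "A \<noteq> {}"
  shows "card (A - top_face u A) < card A"
  using top_face_nonempty[OF assms, of u] top_face_subset[of u A] assms(1)
  by (intro psubset_card_mono) auto

lemma peel_le_card: "peel N A k \<Longrightarrow> finite A \<Longrightarrow> k \<le> card A"
proof (induction rule: peel.induct)
  case (step A u k)
  thus ?case using card_Diff_top_face[of A u] by simp
qed simp

lemma peel_exists:
  assumes "finite A" "u \<in> N"
  shows "\<exists>k. peel N A k"
  using assms(1)
proof (induction "card A" arbitrary: A rule: less_induct)
  case less
  show ?case
  proof (cases "A = {}")
    case False
    thus ?thesis using less card_Diff_top_face[of A u] peel.step[OF False assms(2)] by blast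
  qed (use peel.empty in blast)
qed

lemma peel_le_depth:
  assumes "finite A" "peel N A k"
  shows "k \<le> depth N A"
proof -
  have "finite {k. peel N A k}"
    by (rule finite_subset[of _ "{..card A}"]) (use peel_le_card assms(1) in auto)
  thus ?thesis unfolding depth_def using assms(2) by (intro Max_ge) auto
qed

lemma peel_depth:
  assumes "finite A" "u \<in> N"
  shows "peel N A (depth N A)"
proof -
  have "finite {k. peel N A k}"
    by (rule finite_subset[of _ "{..card A}"]) (use peel_le_card assms(1) in auto)
  hence "Max {k. peel N A k} \<in> {k. peel N A k}"
    using peel_exists[OF assms] by (intro Max_in) auto
  thus ?thesis unfolding depth_def by simp
qed

section \<open>Bounds in terms of the peeling depth\<close>

lemma depth_step:
  assumes "finite A" "A \<noteq> {}" "u \<in> N"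
  shows "Suc (depth N (A - top_face u A)) \<le> depth N A"
  using assms(1) peel.step[OF assms(2,3) peel_depth[OF finite_Diff[OF assms(1)] assms(3)]]
  by (rule peel_le_depth)

text \<open>Peeling in the single direction \<open>u\<close> throughout takes one step per
  level.\<close>

lemma card_levels_le_depth:
  assumes "finite A" "u \<in> N"
  shows "card ((\<bullet>) u ` A) \<le> depth N A"
  using assms(1)
proof (induction "card A" arbitrary: A rule: less_induct)
  case less
  show ?case
  proof (cases "A = {}")
    case False
    obtain p where p: "p \<in> top_face u A" using top_face_nonempty[OF less(2) False] by blast
    have "(\<bullet>) u ` A \<subseteq> insert (u \<bullet> p) ((\<bullet>) u ` (A - top_face u A))"
      using top_face_eq[OF p] by auto
    hence "card ((\<bullet>) u ` A) \<le> card (insert (u \<bullet> p) ((\<bullet>) u ` (A - top_face u A)))"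
      using less(2) by (intro card_mono) auto
    also have "\<dots> \<le> Suc (card ((\<bullet>) u ` (A - top_face u A)))"
      by (rule card_insert_le_m1) auto
    also have "\<dots> \<le> Suc (depth N (A - top_face u A))"
      using less card_Diff_top_face[of A u] False by simp
    also have "\<dots> \<le> depth N A" by (rule depth_step) (use less False assms in auto)
    finally show ?thesis .
  qed simp
qed

text \<open>A surviving point of the top face keeps the maximum of \<open>v\<close> where it
  was.\<close>

lemma top_face_Diff:
  assumes "finite A" "\<not> top_face v A \<subseteq> S"
  shows "top_face v (A - S) = top_face v A - S"
proof -
  obtain p where "p \<in> top_face v A" "p \<notin> S" using assms by blast
  thus ?thesis unfolding top_face_def by (auto intro: order_trans)
qed

text \<open>Models the outer normals of a triangle, as rotated edge vectors: these close up, which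
  is \<open>sum_N\<close>, and any two of them serve as coordinates, which is
  \<open>inner_inj\<close>.\<close>

locale three_directions =
  fixes N :: "'a::euclidean_space set"
  assumes card_N: "card N = 3"
    and sum_N: "\<Sum>N = 0"
    and inner_inj: "\<lbrakk>u \<in> N; v \<in> N; u \<noteq> v; u \<bullet> p = u \<bullet> q; v \<bullet> p = v \<bullet> q\<rbrakk> \<Longrightarrow> p = q"
begin

lemma finite_N: "finite N"
  using card_N card.infinite by fastforce

lemma obtain_other:
  obtains v where "v \<in> N" "v \<noteq> u"
  using card_N by (metis card_1_singleton_iff is_singletonI' is_singleton_altdef numeral_eq_one_iff
      semiring_norm(86) card.empty zero_neq_numeral)

lemma card_top_Int_top:
  assumes "u \<in> N" "v \<in> N" "u \<noteq> v"
  shows "card (top_face u A \<inter> top_face v A) \<le> 1"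
proof (cases "top_face u A \<inter> top_face v A = {}")
  case False
  then obtain p where p: "p \<in> top_face u A" "p \<in> top_face v A" by blast
  have "top_face u A \<inter> top_face v A \<subseteq> {p}"
    using inner_inj[OF assms] top_face_eq[OF p(1)] top_face_eq[OF p(2)] by blast
  from card_mono[OF _ this] show ?thesis by simp
qed simp

lemma inj_on_top_face:
  assumes "u \<in> N" "v \<in> N" "u \<noteq> v"
  shows "inj_on ((\<bullet>) v) (top_face u A)"
  using inner_inj[OF assms] top_face_eq[of _ u A] by (auto intro!: inj_onI)

text \<open>A second direction separates the points of the face, so they occupy that many of its
  levels.\<close>

lemma card_top_face_le_depth:
  assumes "finite A" "u \<in> N"
  shows "card (top_face u A) \<le> depth N A"
proof -
  obtain v where v: "v \<in> N" "v \<noteq> u" by (rule obtain_other)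
  have "card (top_face u A) = card ((\<bullet>) v ` top_face u A)"
    using inj_on_top_face[of u v A] v assms(2) by (simp add: card_image)
  also have "\<dots> \<le> card ((\<bullet>) v ` A)"
    using assms(1) top_face_subset[of u A] by (intro card_mono image_mono) auto
  also have "\<dots> \<le> depth N A" by (rule card_levels_le_depth) (use assms v in auto)
  finally show ?thesis .
qed

text \<open>Disjointness leaves the highest level of \<open>v\<close> free of points of
  \<open>top_face u A\<close>, a gain of one over \<open>card_top_face_le_depth\<close>.\<close>

lemma card_top_face_less_depth:
  assumes "finite A" "A \<noteq> {}" "u \<in> N" "v \<in> N" "u \<noteq> v" "top_face u A \<inter> top_face v A = {}"
  shows "card (top_face u A) < depth N A"
proof -
  obtain p where p: "p \<in> top_face v A" using top_face_nonempty[OF assms(1,2)] by blast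
  have "v \<bullet> p \<notin> (\<bullet>) v ` top_face u A"
  proof
    assume "v \<bullet> p \<in> (\<bullet>) v ` top_face u A"
    then obtain q where q: "q \<in> top_face u A" "v \<bullet> p = v \<bullet> q" by blast
    hence "q \<in> top_face v A" using p by (auto simp: top_face_def)
    thus False using q assms(6) by blast
  qed
  have "card (top_face u A) = card ((\<bullet>) v ` top_face u A)"
    using inj_on_top_face[of u v A] assms by (simp add: card_image)
  also have "\<dots> < card ((\<bullet>) v ` A)"
    using assms(1) top_face_subset[of u A] top_face_subset[of v A] p \<open>v \<bullet> p \<notin> _\<close>
    by (intro psubset_card_mono) auto
  also have "\<dots> \<le> depth N A" by (rule card_levels_le_depth) (use assms in auto)
  finally show ?thesis .
qed

text \<open>Removing a top face costs at most \<open>depth N A\<close> points and lowers the depth,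
  so the points are bounded by the sum of the numbers up to the depth.\<close>

lemma card_le_depth:
  assumes "finite A"
  shows "2 * card A \<le> depth N A * Suc (depth N A)"
  using assms
proof (induction "card A" arbitrary: A rule: less_induct)
  case less
  show ?case
  proof (cases "A = {}")
    case False
    obtain u where u: "u \<in> N" using obtain_other by blast
    let ?A = "A - top_face u A"
    have step: "Suc (depth N ?A) \<le> depth N A" by (rule depth_step) (use less u False in auto)
    have "card A = card (top_face u A) + card ?A"
      using less(2) top_face_subset[of u A]
      by (metis card_Diff_subset card_mono finite_top_face le_add_diff_inverse)
    hence "2 * card A \<le> 2 * depth N A + 2 * card ?A"
      using card_top_face_le_depth[OF less(2) u] by simp
    also have "2 * card ?A \<le> depth N ?A * Suc (depth N ?A)"
      using less card_Diff_top_face[OF less(2) False] by simp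
    also have "\<dots> \<le> (depth N A - 1) * depth N A"
      by (intro mult_mono) (use step in auto)
    also have "2 * depth N A + (depth N A - 1) * depth N A = depth N A * Suc (depth N A)"
      using step by (cases "depth N A") auto
    finally show ?thesis by simp
  qed simp
qed

text \<open>The last hypothesis makes the removal of the second face a genuine peeling step, so what
  remains has depth at most \<open>depth N A - 2\<close> and \<open>card_le_depth\<close>
  applies.\<close>

lemma card_two_top_faces:
  assumes "finite A" "u \<in> N" "v \<in> N" "\<not> top_face v A \<subseteq> top_face u A"
  shows "2 \<le> depth N A"
    "2 * card (A - (top_face u A \<union> top_face v A)) \<le> (depth N A - 2) * (depth N A - 1)"
proof -
  let ?A1 = "A - top_face u A" and ?A2 = "A - (top_face u A \<union> top_face v A)"
  have ne: "A \<noteq> {}" "?A1 \<noteq> {}" using assms(4) top_face_subset[of v A] by auto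
  have "?A2 = ?A1 - top_face v ?A1" using top_face_Diff[OF assms(1,4)] by auto
  hence "Suc (depth N ?A2) \<le> depth N ?A1"
    using depth_step[of ?A1 v N] assms ne by simp
  moreover have "Suc (depth N ?A1) \<le> depth N A" by (rule depth_step) (use assms ne in auto)
  ultimately have le: "Suc (Suc (depth N ?A2)) \<le> depth N A" by simp
  thus "2 \<le> depth N A" by simp
  have "2 * card ?A2 \<le> depth N ?A2 * Suc (depth N ?A2)" using assms(1) by (intro card_le_depth) auto
  also have "\<dots> \<le> (depth N A - 2) * (depth N A - 1)" by (intro mult_mono) (use le in auto)
  finally show "2 * card ?A2 \<le> (depth N A - 2) * (depth N A - 1)" .
qed

text \<open>The products of \<open>q - p\<close> with the three directions are at most zero and add
  up to zero, so they all vanish.\<close>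

lemma top_face_triple:
  assumes "u \<in> N" "v \<in> N" "w \<in> N" "u \<noteq> v" "u \<noteq> w" "v \<noteq> w"
    and "p \<in> top_face u A" "p \<in> top_face v A" "p \<in> top_face w A" "q \<in> A"
  shows "q = p"
proof -
  have "N = {u, v, w}"
    using assms card_N finite_N by (intro card_seteq[symmetric]) auto
  hence "u + v + w = 0" using sum_N assms(4-6) by (simp add: add.assoc)
  hence "u \<bullet> (q - p) + v \<bullet> (q - p) + w \<bullet> (q - p) = 0" by (metis inner_add_left inner_zero_left)
  moreover have "u \<bullet> (q - p) \<le> 0" "v \<bullet> (q - p) \<le> 0" "w \<bullet> (q - p) \<le> 0"
    using assms by (auto simp: top_face_def inner_diff_right)
  ultimately have "u \<bullet> q = u \<bullet> p" "v \<bullet> q = v \<bullet> p" by (auto simp: inner_diff_right)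
  thus ?thesis using inner_inj assms by blast
qed

text \<open>\<open>X\<close> will be the union of the three top faces. With
  \<open>depth N A = k + 2\<close>, twice the number of points is at most
  \<open>card X + k + 3\<close> for the two faces plus \<open>k * (k + 1)\<close> for the rest, and
  \<open>k + 3 + k * (k + 1) = (k + 1)\<^sup>2 + 2\<close>.\<close>

lemma card_le_depth_boundary_aux:
  assumes A: "finite A" "u \<in> N" "v \<in> N" "\<not> top_face v A \<subseteq> top_face u A"
    and X: "finite X" "2 * card (top_face u A \<union> top_face v A) \<le> card X + Suc (depth N A)"
  shows "2 * card A \<le> (depth N A - 1)\<^sup>2 + card X + 2"
proof -
  let ?U = "top_face u A \<union> top_face v A"
  obtain k where k: "depth N A = k + 2"
    using card_two_top_faces(1)[OF A] by (metis add.commute le_Suc_ex)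
  have "card A = card ?U + card (A - ?U)"
    using A(1) top_face_subset[of u A] top_face_subset[of v A]
    by (metis Un_least card_Diff_subset card_mono finite_subset le_add_diff_inverse)
  hence "2 * card A \<le> card X + (k + 3) + k * (k + 1)"
    using card_two_top_faces(2)[OF A] X k by simp
  also have "\<dots> = (k + 1)\<^sup>2 + card X + 2" by (simp add: power2_eq_square)
  finally show ?thesis using k by simp
qed

text \<open>In the main case the faces of \<open>u\<close> and \<open>v\<close> are peeled and a
  largest one, that of \<open>w\<close>, is kept. It meets each of the others in at most one point,
  so it adds at least \<open>card (top_face v A) - 2\<close> points to the union. This pays for the
  face of \<open>v\<close>, and the depth pays for that of \<open>u\<close>.\<close>

lemma card_le_depth_boundary:
  assumes "finite A" "2 \<le> card A"
  shows "2 * card A \<le> (depth N A - 1)\<^sup>2 + card (\<Union>u\<in>N. top_face u A) + 2"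
proof -
  let ?T = "\<lambda>u. top_face u A"
  let ?X = "\<Union>u\<in>N. ?T u"
  have ne: "A \<noteq> {}" using assms by auto
  obtain w where w: "w \<in> N" "\<And>u. u \<in> N \<Longrightarrow> card (?T u) \<le> card (?T w)"
  proof -
    have "Max ((\<lambda>u. card (?T u)) ` N) \<in> (\<lambda>u. card (?T u)) ` N"
      using finite_N card_N by (intro Max_in) auto
    then obtain w where "w \<in> N" "card (?T w) = Max ((\<lambda>u. card (?T u)) ` N)" by auto
    thus thesis using that finite_N by auto
  qed
  have "card (N - {w}) = 2" using card_N w(1) finite_N by simp
  then obtain u v where uv: "N - {w} = {u, v}" "u \<noteq> v" unfolding card_2_iff by blast
  have "u \<in> N - {w}" "v \<in> N - {w}" unfolding uv(1) by simp_all
  hence N: "u \<in> N" "v \<in> N" "u \<noteq> w" "v \<noteq> w" by simp_all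
  have "N = insert w (N - {w})" using w(1) by blast
  hence "N = {w, u, v}" unfolding uv(1) .
  hence X: "?X = ?T u \<union> ?T v \<union> ?T w" by (simp only: UN_insert) blast
  have fin: "finite (?T x)" for x using assms by simp
  have Xfin: "finite ?X" using finite_N fin by blast
  have le: "card (?T x) \<le> depth N A" if "x \<in> N" for x
    using that assms by (intro card_top_face_le_depth) auto
  show ?thesis
  proof (cases "?T u = ?T v")
    \<comment> \<open>Equal faces are a single point, and removing both is just one step. By
      \<open>top_face_triple\<close> the face of \<open>w\<close> avoids this point, so
      \<open>u\<close> and \<open>w\<close> are peeled instead.\<close>
    case True
    have one: "card (?T u) \<le> 1" using card_top_Int_top[of u v A] N uv True by simp
    have "?T w \<inter> ?T u = {}"
    proof (rule ccontr)
      assume "?T w \<inter> ?T u \<noteq> {}"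
      then obtain p where p: "p \<in> ?T u" "p \<in> ?T v" "p \<in> ?T w" using True by auto
      have "A \<subseteq> {p}"
        using top_face_triple[OF N(1,2) w(1) uv(2) N(3,4) p] by blast
      from card_mono[OF _ this] assms(2) show False by simp
    qed
    hence "\<not> ?T w \<subseteq> ?T u" using top_face_nonempty[OF assms(1) ne, of w] by blast
    moreover have "?X = ?T u \<union> ?T w" using X True by auto
    moreover have "card (?T u \<union> ?T w) \<le> Suc (depth N A)"
      using card_Un_le[of "?T u" "?T w"] one le[OF w(1)] by simp
    ultimately show ?thesis
      using N w(1) Xfin assms(1) by (intro card_le_depth_boundary_aux[of A u w]) auto
  next
    case False
    let ?U = "?T u \<union> ?T v"
    have cU: "card ?U + card (?T u \<inter> ?T v) = card (?T u) + card (?T v)"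
      using card_Un_Int[OF fin fin] by simp
    have "?T w - ?U = ?T w - (?T w \<inter> ?T u \<union> ?T w \<inter> ?T v)" by blast
    hence "card (?T w - ?U) = card (?T w) - card (?T w \<inter> ?T u \<union> ?T w \<inter> ?T v)"
      using fin by (simp add: card_Diff_subset)
    moreover have "card (?T w \<inter> ?T u \<union> ?T w \<inter> ?T v) \<le> 2"
      using card_Un_le[of "?T w \<inter> ?T u" "?T w \<inter> ?T v"] card_top_Int_top[of w u A]
        card_top_Int_top[of w v A] N w(1) by simp
    ultimately have w2: "card (?T w) \<le> card (?T w - ?U) + 2" by simp
    have "?X = ?U \<union> (?T w - ?U)" using X by blast
    hence cX: "card ?X = card ?U + card (?T w - ?U)"
      using fin by (metis Diff_disjoint card_Un_disjoint finite_Diff finite_UnI)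
    \<comment> \<open>Either disjointness gains a level, or the common point makes up for
      it.\<close>
    have "card (?T u) \<le> depth N A - 1 + card (?T u \<inter> ?T v)"
    proof (cases "?T u \<inter> ?T v = {}")
      case True
      thus ?thesis using card_top_face_less_depth[OF assms(1) ne N(1,2) uv(2)] by simp
    next
      case False
      hence "card (?T u \<inter> ?T v) \<ge> 1" using fin by (simp add: Suc_leI card_gt_0_iff)
      thus ?thesis using le[OF N(1)] by simp
    qed
    \<comment> \<open>Guards the truncated subtraction \<open>depth N A - 1\<close>.\<close>
    moreover have "1 \<le> depth N A"
      using le[OF N(1)] top_face_nonempty[OF assms(1) ne, of u] fin[of u]
      by (metis One_nat_def Suc_leI card_gt_0_iff order_trans)
    ultimately have *: "2 * card ?U \<le> card ?X + Suc (depth N A)"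
      using cU cX w2 w(2)[OF N(2)] by linarith
    show ?thesis
    \<comment> \<open>The faces differ, so one of them is not contained in the other; that one is
      peeled second.\<close>
    proof (cases "?T v \<subseteq> ?T u")
      case True
      hence "\<not> ?T u \<subseteq> ?T v" using False by blast
      thus ?thesis using * N Xfin assms(1)
        by (intro card_le_depth_boundary_aux[of A v u]) (auto simp: Un_commute)
    next
      case False
      thus ?thesis using * N Xfin assms(1)
        by (intro card_le_depth_boundary_aux[of A u v]) auto
    qed
  qed
qed

end

section \<open>Heights from a peeling\<close>

text \<open>The levels of \<open>u\<close> beyond \<open>a\<close> that are vertices of the lower hull of the points \<open>(u \<bullet> p, f p)\<close>.\<close>

definition reached :: "'a::euclidean_space set \<Rightarrow> ('a \<Rightarrow> real) \<Rightarrow> 'a \<Rightarrow> 'a \<Rightarrow> real set" where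
  "reached A f a u = {t. u \<bullet> a < t \<and> (\<exists>r>0. \<exists>p\<in>A. u \<bullet> p = t \<and>
     (\<forall>q\<in>A. u \<bullet> q \<noteq> t \<longrightarrow> f p - r * t < f q - r * (u \<bullet> q)))}"

lemma finite_reached:
  assumes "finite A"
  shows "finite (reached A f a u)"
  by (rule finite_subset[of _ "(\<bullet>) u ` A"]) (use assms in \<open>auto simp: reached_def\<close>)

text \<open>Choosing slope and point for all reached levels at once turns their survival under a
  change of heights into finitely many strict inequalities.\<close>

lemma reached_witnesses:
  obtains R w where "\<And>v t. t \<in> reached A f a v \<Longrightarrow> R (v, t) > 0 \<and> w (v, t) \<in> A \<and> v \<bullet> w (v, t) = t \<and>
    (\<forall>q\<in>A. v \<bullet> q \<noteq> t \<longrightarrow> f (w (v, t)) - R (v, t) * t < f q - R (v, t) * (v \<bullet> q))"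
proof -
  define Q where "Q x y \<longleftrightarrow> (snd x \<in> reached A f a (fst x) \<longrightarrow> fst y > 0 \<and> snd y \<in> A \<and>
    fst x \<bullet> snd y = snd x \<and> (\<forall>q\<in>A. fst x \<bullet> q \<noteq> snd x \<longrightarrow>
      f (snd y) - fst y * snd x < f q - fst y * (fst x \<bullet> q)))" for x :: "'a \<times> real" and y :: "real \<times> 'a"
  have "\<forall>x. \<exists>y. Q x y" by (auto simp: reached_def Q_def)
  then obtain W where W: "\<And>x. Q x (W x)" using choice by blast
  show thesis
    by (rule that[of "fst \<circ> W" "snd \<circ> W"]) (use W in \<open>force simp: Q_def\<close>)
qed

lemma eventually_less_add_at_top: "\<forall>\<^sub>F H in at_top. (r::real) < H + s"
  using eventually_gt_at_top[of "r - s"] by eventually_elim simp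

lemma eventually_less_mult_at_top: "0 < d \<Longrightarrow> \<forall>\<^sub>F C in at_top. (r::real) < C * d"
  using eventually_gt_at_top[of "r / d"] by eventually_elim (simp add: pos_divide_less_eq)

text \<open>The tangent plane of the paraboloid at \<open>p\<close> touches it nowhere else, so
  paraboloid heights make every point a vertex of the lower hull.\<close>

lemma norm_tangent_less:
  fixes p q :: "'a::real_inner"
  assumes "p \<noteq> q"
  shows "p \<bullet> p - (2 *\<^sub>R p) \<bullet> p < q \<bullet> q - (2 *\<^sub>R p) \<bullet> q"
proof -
  have "0 < (q - p) \<bullet> (q - p)" using assms by simp
  thus ?thesis by (simp add: inner_diff_left inner_diff_right inner_commute)
qed

text \<open>Each top face, when put back, is lifted so high that it becomes one more vertex of the lower
  hull of the projection along its direction and disturbs no strict inequality obtained before.\<close>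

lemma peel_heights:
  assumes "peel N A k" "finite A" "A \<noteq> {}" "finite N"
  shows "\<exists>f a. a \<in> A \<and> (\<forall>q\<in>A - {a}. f a < f q) \<and>
    (\<forall>p\<in>A. \<exists>c. \<forall>q\<in>A - {p}. f p - c \<bullet> p < f q - c \<bullet> q) \<and>
    k \<le> Suc (card (SIGMA u:N. reached A f a u))"
  using assms
proof (induction rule: peel.induct)
  case empty
  thus ?case by simp
next
  case (step A u k)
  let ?L = "top_face u A" and ?A = "A - top_face u A"
  show ?case
  proof (cases "?A = {}")
    case True
    hence "k = 0" using step.hyps(3) by (auto elim: peel.cases)
    obtain a where a: "a \<in> A" using step.hyps(1) by blast
    \<comment> \<open>A paraboloid with its minimum at \<open>a\<close>, up to a constant. The first
      face put back is not counted, whence the \<open>Suc\<close> in the bound.\<close>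
    define f where "f p = p \<bullet> p - (2 *\<^sub>R a) \<bullet> p" for p
    have "f p - (2 *\<^sub>R (p - a)) \<bullet> p < f q - (2 *\<^sub>R (p - a)) \<bullet> q" if "q \<in> A - {p}" for p q
      using norm_tangent_less[of p q] that
      by (auto simp: f_def inner_diff_left scaleR_diff_right)
    moreover have "f a < f q" if "q \<in> A - {a}" for q
      using norm_tangent_less[of a q] that by (auto simp: f_def)
    ultimately show ?thesis using a \<open>k = 0\<close> by (intro exI[of _ f] exI[of _ a]) blast
  next
    case False
    then obtain f a where a: "a \<in> ?A" and fa: "\<And>q. q \<in> ?A - {a} \<Longrightarrow> f a < f q"
      and fc: "\<forall>p\<in>?A. \<exists>c. \<forall>q\<in>?A - {p}. f p - c \<bullet> p < f q - c \<bullet> q"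
      and k: "k \<le> Suc (card (SIGMA u:N. reached ?A f a u))"
      using step.IH step.prems by auto
    from fc obtain c where c: "\<And>p q. p \<in> ?A \<Longrightarrow> q \<in> ?A - {p} \<Longrightarrow> f p - c p \<bullet> p < f q - c p \<bullet> q"
      by metis
    obtain p0 where p0: "p0 \<in> ?L" using top_face_nonempty step.prems by blast
    define t0 where "t0 = u \<bullet> p0"
    have L: "u \<bullet> p = t0" if "p \<in> ?L" for p using top_face_eq[OF that p0] t0_def by simp
    have A': "u \<bullet> q < t0" if q: "q \<in> ?A" for q
    proof -
      have "u \<bullet> q \<le> t0" using q p0 by (simp add: top_face_def t0_def)
      moreover have "u \<bullet> q \<noteq> t0" using q p0 by (auto simp: top_face_def t0_def)
      ultimately show ?thesis by simp
    qed
    have finL: "finite ?L" "finite ?A" using step.prems(1) by auto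
    let ?V = "SIGMA v:N. reached ?A f a v"
    have finV: "finite ?V" using step.prems(3) finite_reached[OF finL(2)] by blast
    obtain R w where W: "\<And>v t. t \<in> reached ?A f a v \<Longrightarrow>
        R (v, t) > 0 \<and> w (v, t) \<in> ?A \<and> v \<bullet> w (v, t) = t \<and>
        (\<forall>q\<in>?A. v \<bullet> q \<noteq> t \<longrightarrow> f (w (v, t)) - R (v, t) * t < f q - R (v, t) * (v \<bullet> q))"
      by (rule reached_witnesses[of ?A f a]) blast
    have Rw: "R x > 0 \<and> w x \<in> ?A \<and> fst x \<bullet> w x = snd x \<and>
        (\<forall>q\<in>?A. fst x \<bullet> q \<noteq> snd x \<longrightarrow> f (w x) - R x * snd x < f q - R x * (fst x \<bullet> q))"
      if "x \<in> ?V" for x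
      using W[of "snd x" "fst x"] that by auto
    have "\<forall>\<^sub>F H in at_top. \<forall>q\<in>?L. f a < H + q \<bullet> q"
      using finL by (intro eventually_ball_finite eventually_less_add_at_top ballI)
    moreover have "\<forall>\<^sub>F H in at_top. \<forall>p\<in>?A. \<forall>q\<in>?L. f p - c p \<bullet> p < H + (q \<bullet> q - c p \<bullet> q)"
      using finL by (intro eventually_ball_finite eventually_less_add_at_top ballI)
    moreover have "\<forall>\<^sub>F H in at_top. \<forall>x\<in>?V. \<forall>q\<in>?L.
        f (w x) - R x * snd x < H + (q \<bullet> q - R x * (fst x \<bullet> q))"
      using finL finV by (intro eventually_ball_finite eventually_less_add_at_top ballI)
    ultimately have "\<forall>\<^sub>F H in at_top. (\<forall>q\<in>?L. f a < H + q \<bullet> q) \<and>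
        (\<forall>p\<in>?A. \<forall>q\<in>?L. f p - c p \<bullet> p < H + (q \<bullet> q - c p \<bullet> q)) \<and>
        (\<forall>x\<in>?V. \<forall>q\<in>?L. f (w x) - R x * snd x < H + (q \<bullet> q - R x * (fst x \<bullet> q)))"
      by (intro eventually_conj)
    from eventually_happens'[OF trivial_limit_at_top_linorder this]
    \<comment> \<open>These strict inequalities compare the finitely many old witnesses with the new
      points, and all of them hold once \<open>H\<close> is large.\<close>
    obtain H where H1: "\<And>q. q \<in> ?L \<Longrightarrow> f a < H + q \<bullet> q"
      and H2: "\<And>p q. p \<in> ?A \<Longrightarrow> q \<in> ?L \<Longrightarrow> f p - c p \<bullet> p < H + (q \<bullet> q - c p \<bullet> q)"
      and H3: "\<And>x q. x \<in> ?V \<Longrightarrow> q \<in> ?L \<Longrightarrow> f (w x) - R x * snd x < H + (q \<bullet> q - R x * (fst x \<bullet> q))"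
      by (elim exE conjE) (rule that, (drule (1) bspec, assumption | drule (1) bspec, drule (1) bspec, assumption)+)
    \<comment> \<open>The quadratic term makes the points of the face vertices among
      themselves.\<close>
    define g where "g q = (if q \<in> ?L then H + q \<bullet> q else f q)" for q
    have gL: "g q = H + q \<bullet> q" if "q \<in> ?L" for q using that by (simp add: g_def)
    have gA: "g q = f q" if "q \<in> ?A" for q using that by (simp add: g_def)
    have split: "q \<in> A \<longleftrightarrow> q \<in> ?L \<or> q \<in> ?A" for q using top_face_subset by blast
    have g1: "\<forall>q\<in>A - {a}. g a < g q"
      using fa H1 gL gA a split by (metis Diff_iff)
    have g2: "\<exists>c. \<forall>q\<in>A - {p}. g p - c \<bullet> p < g q - c \<bullet> q" if p: "p \<in> A" for p
    proof (cases "p \<in> ?L")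
      case False
      hence pA: "p \<in> ?A" using p by blast
      have "g p - c p \<bullet> p < g q - c p \<bullet> q" if "q \<in> A - {p}" for q
        using that c[OF pA, of q] H2[OF pA, of q] gL[of q] gA[of q] gA[OF pA] by fastforce
      thus ?thesis by blast
    next
      case True
      have "\<forall>\<^sub>F C in at_top. \<forall>q\<in>?A. g p - (2 *\<^sub>R p) \<bullet> p - (g q - (2 *\<^sub>R p) \<bullet> q) < C * (t0 - u \<bullet> q)"
        using finL A' by (intro eventually_ball_finite ballI eventually_less_mult_at_top) auto
      \<comment> \<open>On the face \<open>u\<close> is constant, so a steep tilt \<open>C\<close>
        along \<open>u\<close> leaves the comparison there to the paraboloid and makes all old
        points worse than \<open>p\<close>.\<close>
      then obtain C where C: "\<And>q. q \<in> ?A \<Longrightarrow>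
          g p - (2 *\<^sub>R p) \<bullet> p - (g q - (2 *\<^sub>R p) \<bullet> q) < C * (t0 - u \<bullet> q)"
        using eventually_happens'[OF trivial_limit_at_top_linorder] by blast
      have "g p - (C *\<^sub>R u + 2 *\<^sub>R p) \<bullet> p < g q - (C *\<^sub>R u + 2 *\<^sub>R p) \<bullet> q" if q: "q \<in> A - {p}" for q
      proof (cases "q \<in> ?L")
        case True
        thus ?thesis using q norm_tangent_less[of p q] L[OF True] L[OF \<open>p \<in> ?L\<close>]
            gL[OF True] gL[OF \<open>p \<in> ?L\<close>] by (auto simp: inner_add_left)
      next
        case False
        thus ?thesis using q C[of q] L[OF \<open>p \<in> ?L\<close>] by (auto simp: inner_add_left algebra_simps)
      qed
      thus ?thesis by blast
    qed
    have old: "?V \<subseteq> (SIGMA v:N. reached A g a v)"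
    proof
      fix x assume x: "x \<in> ?V"
      have "g (w x) - R x * snd x < g q - R x * (fst x \<bullet> q)" if "q \<in> A" "fst x \<bullet> q \<noteq> snd x" for q
        using that Rw[OF x] H3[OF x, of q] gL[of q] gA[of q] gA[of "w x"] by fastforce
      moreover have "fst x \<in> N" "fst x \<bullet> a < snd x" using x by (auto simp: reached_def)
      moreover have "w x \<in> A" using Rw[OF x] by blast
      ultimately have "fst x \<in> N" "snd x \<in> reached A g a (fst x)"
        unfolding reached_def using Rw[OF x] by blast+
      thus "x \<in> (SIGMA v:N. reached A g a v)" by (metis SigmaI prod.collapse)
    qed
    have new: "t0 \<in> reached A g a u"
    proof -
      have "\<forall>\<^sub>F r in at_top. \<forall>q\<in>?A. g p0 - g q < r * (t0 - u \<bullet> q)"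
        using finL A' by (intro eventually_ball_finite ballI eventually_less_mult_at_top) auto
      hence "\<forall>\<^sub>F r in at_top. 0 < r \<and> (\<forall>q\<in>?A. g p0 - g q < r * (t0 - u \<bullet> q))"
        using eventually_gt_at_top[of "0::real"] by eventually_elim simp
      then obtain r where r: "r > 0" "\<And>q. q \<in> ?A \<Longrightarrow> g p0 - g q < r * (t0 - u \<bullet> q)"
        using eventually_happens'[OF trivial_limit_at_top_linorder] by blast
      have "g p0 - r * t0 < g q - r * (u \<bullet> q)" if "q \<in> A" "u \<bullet> q \<noteq> t0" for q
        using r(2)[of q] that L[of q] by (auto simp: algebra_simps)
      moreover have "p0 \<in> A" using p0 top_face_subset by blast
      ultimately show ?thesis
        unfolding reached_def mem_Collect_eq using r(1) A'[OF a] t0_def by blast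
    qed
    \<comment> \<open>\<open>t0\<close> lies above every \<open>u\<close>-level of the old points,
      so this pair is one more.\<close>
    have "(u, t0) \<notin> ?V" using A' by (auto simp: reached_def)
    hence "Suc (card ?V) = card (insert (u, t0) ?V)" using finV by simp
    also have "\<dots> \<le> card (SIGMA v:N. reached A g a v)"
      using old new step.hyps(2) step.prems finite_reached[OF step.prems(1)]
      by (intro card_mono finite_SigmaI) auto
    finally have "Suc k \<le> Suc (card (SIGMA v:N. reached A g a v))" using k by simp
    thus ?thesis using g1 g2 a by blast
  qed
qed

section \<open>Generic perturbation of the heights\<close>

text \<open>Perturbing the heights by distinct powers of an infinitesimal makes them generic.\<close>

lemma eventually_perturbed_sum_nonzero:
  fixes f m :: "'a \<Rightarrow> real"
  assumes "finite Y" "inj_on i Y" "y \<in> Y" "m y \<noteq> 0"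
  shows "\<forall>\<^sub>F s in at_right 0. (\<Sum>p\<in>Y. m p * (f p + s ^ Suc (i p))) \<noteq> 0"
proof -
  define P where "P = [:\<Sum>p\<in>Y. m p * f p:] + (\<Sum>p\<in>Y. monom (m p) (Suc (i p)))"
  have P: "poly P s = (\<Sum>p\<in>Y. m p * (f p + s ^ Suc (i p)))" for s
    by (simp add: P_def poly_sum poly_monom sum.distrib distrib_left)
  \<comment> \<open>Injectivity of \<open>i\<close> reserves this power of \<open>s\<close> for
    \<open>y\<close>; \<open>Suc\<close> keeps it apart from the constant term and lets the
    perturbation vanish as \<open>s\<close> tends to 0.\<close>
  have "coeff P (Suc (i y)) = (\<Sum>p\<in>Y. if p = y then m y else 0)"
    using assms(2,3) by (auto simp: P_def coeff_sum inj_on_eq_iff intro!: sum.cong)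
  also have "\<dots> = m y" using assms by simp
  finally have "P \<noteq> 0" using assms(4) by auto
  hence "finite {s. poly P s = 0}" by (rule poly_roots_finite)
  hence "\<forall>\<^sub>F s in at_right 0. \<forall>z\<in>{s. poly P s = 0}. s \<noteq> z"
    by (intro eventually_ball_finite ballI eventually_neq_at_within)
  thus ?thesis by eventually_elim (auto simp: P)
qed

text \<open>The slope is a parameter because one genericity condition forbids only slopes along a
  given direction.\<close>

definition affine_on :: "'a::euclidean_space set \<Rightarrow> ('a \<Rightarrow> real) \<Rightarrow> 'a \<Rightarrow> bool" where
  "affine_on Y h c \<longleftrightarrow> (\<exists>k. \<forall>p\<in>Y. h p = c \<bullet> p + k)"

lemma affine_on_lower: "affine_on (lower P h c) h c"
proof (cases "lower P h c = {}")
  case False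
  then obtain q where q: "q \<in> lower P h c" by blast
  have "h p = c \<bullet> p + (h q - c \<bullet> q)" if "p \<in> lower P h c" for p
    using lower_eq[OF that q] by simp
  thus ?thesis unfolding affine_on_def by blast
qed (simp add: affine_on_def)

text \<open>The strict inequalities from \<open>peel_heights\<close> survive for small
  \<open>s\<close>, and each genericity condition excludes only roots of a nonzero polynomial in
  \<open>s\<close>. The fifth conclusion makes the cells simplices; the last two keep rays in the
  directions of \<open>N\<close> away from cells with more than two generators.\<close>

lemma generic_heights:
  assumes "peel N A k" "finite A" "A \<noteq> {}" "finite N"
  obtains h a where "a \<in> A" "\<And>q. q \<in> A - {a} \<Longrightarrow> h a < h q"
    "\<And>p. p \<in> A \<Longrightarrow> \<exists>c. \<forall>q\<in>A - {p}. h p - c \<bullet> p < h q - c \<bullet> q"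
    "k \<le> Suc (card (SIGMA u:N. reached A h a u))"
    "\<And>Y c. \<lbrakk>Y \<subseteq> A; affine_dependent Y\<rbrakk> \<Longrightarrow> \<not> affine_on Y h c"
    "inj_on h A"
    "\<And>u p q r s. \<lbrakk>u \<in> N; {p, q, r} \<subseteq> A; u \<bullet> p \<noteq> u \<bullet> q; u \<bullet> q \<noteq> u \<bullet> r; u \<bullet> p \<noteq> u \<bullet> r\<rbrakk>
        \<Longrightarrow> \<not> affine_on {p, q, r} h (s *\<^sub>R u)"
proof -
  obtain f a where a: "a \<in> A" and fa: "\<And>q. q \<in> A - {a} \<Longrightarrow> f a < f q"
    and fc: "\<forall>p\<in>A. \<exists>c. \<forall>q\<in>A - {p}. f p - c \<bullet> p < f q - c \<bullet> q"
    and k: "k \<le> Suc (card (SIGMA u:N. reached A f a u))"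
    using peel_heights[OF assms] by blast
  obtain i :: "'a \<Rightarrow> nat" where i: "inj_on i A"
    using finite_imp_inj_to_nat_seg[OF assms(2)] by blast
  define h where "h s p = f p + s ^ Suc (i p)" for s p
  have lim: "((\<lambda>s. h s p) \<longlongrightarrow> f p) (at_right 0)" for p
  proof -
    have "((\<lambda>s. h s p) \<longlongrightarrow> f p + 0 ^ Suc (i p)) (at_right 0)"
      unfolding h_def by (intro tendsto_intros)
    thus ?thesis by simp
  qed
  have stable: "\<forall>\<^sub>F s in at_right 0. h s p - x < h s q - y" if "f p - x < f q - y" for p q x y
  proof -
    have "((\<lambda>s. (h s q - y) - (h s p - x)) \<longlongrightarrow> (f q - y) - (f p - x)) (at_right 0)"
      by (intro tendsto_intros lim)
    hence "\<forall>\<^sub>F s in at_right 0. 0 < (h s q - y) - (h s p - x)"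
      by (rule order_tendstoD(1)) (use that in simp)
    thus ?thesis by eventually_elim simp
  qed
  have ev1: "\<forall>\<^sub>F s in at_right 0. \<forall>q\<in>A - {a}. h s a < h s q"
    using assms(2) fa stable[of a 0 _ 0] by (intro eventually_ball_finite) auto
  from fc obtain c where c: "\<And>p q. p \<in> A \<Longrightarrow> q \<in> A - {p} \<Longrightarrow> f p - c p \<bullet> p < f q - c p \<bullet> q"
    by metis
  have ev2: "\<forall>\<^sub>F s in at_right 0. \<forall>p\<in>A. \<forall>q\<in>A - {p}. h s p - c p \<bullet> p < h s q - c p \<bullet> q"
    using assms(2) c by (intro eventually_ball_finite ballI stable) auto
  let ?V = "SIGMA v:N. reached A f a v"
  have finV: "finite ?V" using assms finite_reached by blast
  obtain R w where W: "\<And>v t. t \<in> reached A f a v \<Longrightarrow>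
      R (v, t) > 0 \<and> w (v, t) \<in> A \<and> v \<bullet> w (v, t) = t \<and>
      (\<forall>q\<in>A. v \<bullet> q \<noteq> t \<longrightarrow> f (w (v, t)) - R (v, t) * t < f q - R (v, t) * (v \<bullet> q))"
    by (rule reached_witnesses[of A f a]) blast
  have Rw: "R x > 0 \<and> w x \<in> A \<and> fst x \<bullet> w x = snd x \<and>
      (\<forall>q\<in>{q\<in>A. fst x \<bullet> q \<noteq> snd x}. f (w x) - R x * snd x < f q - R x * (fst x \<bullet> q))"
    if "x \<in> ?V" for x
    using W[of "snd x" "fst x"] that by auto
  have ev3: "\<forall>\<^sub>F s in at_right 0. \<forall>x\<in>?V. \<forall>q\<in>{q\<in>A. fst x \<bullet> q \<noteq> snd x}.
      h s (w x) - R x * snd x < h s q - R x * (fst x \<bullet> q)"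
    using assms(2) finV Rw by (intro eventually_ball_finite ballI stable) auto
  have generic: "\<forall>\<^sub>F s in at_right 0. (\<Sum>p\<in>Y. m p * h s p) \<noteq> 0"
    if "Y \<subseteq> A" "y \<in> Y" "m y \<noteq> 0" for Y y m
    unfolding h_def using that i assms(2)
    by (intro eventually_perturbed_sum_nonzero) (auto intro: finite_subset inj_on_subset)
  \<comment> \<open>A dependence among the points passes to all heights that are affine on them;
    \<open>generic\<close> rules out such a relation.\<close>
  have affine_sum: "(\<Sum>p\<in>Y. m p * g p) = 0"
    if "affine_on Y g d" "sum m Y = 0" "(\<Sum>p\<in>Y. m p * (d \<bullet> p)) = 0" for Y and g m :: "'a \<Rightarrow> real" and d
  proof -
    obtain k where "\<forall>p\<in>Y. g p = d \<bullet> p + k" using \<open>affine_on Y g d\<close> by (auto simp: affine_on_def)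
    hence "(\<Sum>p\<in>Y. m p * g p) = (\<Sum>p\<in>Y. m p * (d \<bullet> p) + m p * k)"
      by (intro sum.cong) (auto simp: distrib_left)
    also have "\<dots> = (\<Sum>p\<in>Y. m p * (d \<bullet> p)) + sum m Y * k"
      by (simp add: sum.distrib sum_distrib_right)
    finally show ?thesis using that by simp
  qed
  have "\<forall>\<^sub>F s in at_right 0. \<forall>d. \<not> affine_on Y (h s) d" if Y: "Y \<subseteq> A" "affine_dependent Y" for Y
  proof -
    have "finite Y" using Y assms(2) finite_subset by blast
    then obtain m y where m: "sum m Y = 0" "y \<in> Y" "m y \<noteq> 0" "(\<Sum>p\<in>Y. m p *\<^sub>R p) = 0"
      using Y by (auto simp: affine_dependent_explicit_finite)
    have "(\<Sum>p\<in>Y. m p * (d \<bullet> p)) = 0" for d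
      using arg_cong[OF m(4), of "\<lambda>z. d \<bullet> z"] by (simp add: inner_sum_right)
    hence "\<not> affine_on Y (h s) d" if "(\<Sum>p\<in>Y. m p * h s p) \<noteq> 0" for s d
      using affine_sum[of Y "h s" d m] m(1) that by blast
    moreover have "\<forall>\<^sub>F s in at_right 0. (\<Sum>p\<in>Y. m p * h s p) \<noteq> 0"
      by (rule generic) (use Y m in auto)
    ultimately show ?thesis by (auto elim: eventually_mono)
  qed
  hence ev4: "\<forall>\<^sub>F s in at_right 0. \<forall>Y\<in>{Y\<in>Pow A. affine_dependent Y}. \<forall>d. \<not> affine_on Y (h s) d"
    using assms(2) by (intro eventually_ball_finite) auto
  have "\<forall>\<^sub>F s in at_right 0. h s p \<noteq> h s q" if "p \<in> A" "q \<in> A - {p}" for p q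
    using generic[of "{p, q}" p "\<lambda>x. if x = p then 1 else -1"] that by auto
  hence ev5: "\<forall>\<^sub>F s in at_right 0. \<forall>p\<in>A. \<forall>q\<in>A - {p}. h s p \<noteq> h s q"
    using assms(2) by (intro eventually_ball_finite ballI) auto
  define T where "T = {(u, p, q, r). u \<in> N \<and> p \<in> A \<and> q \<in> A \<and> r \<in> A \<and>
    u \<bullet> p \<noteq> u \<bullet> q \<and> u \<bullet> q \<noteq> u \<bullet> r \<and> u \<bullet> p \<noteq> u \<bullet> r}"
  have finT: "finite T"
    by (rule finite_subset[of _ "N \<times> A \<times> A \<times> A"]) (use assms in \<open>auto simp: T_def\<close>)
  have "\<forall>\<^sub>F s in at_right 0. case x of (u, p, q, r) \<Rightarrow> \<forall>d. \<not> affine_on {p, q, r} (h s) (d *\<^sub>R u)"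
    if x: "x \<in> T" for x
  proof -
    obtain u p q r where [simp]: "x = (u, p, q, r)" by (cases x)
    have T: "u \<in> N" "p \<in> A" "q \<in> A" "r \<in> A" "u \<bullet> p \<noteq> u \<bullet> q" "u \<bullet> q \<noteq> u \<bullet> r" "u \<bullet> p \<noteq> u \<bullet> r"
      using x by (auto simp: T_def)
    hence ne: "p \<noteq> q" "q \<noteq> r" "p \<noteq> r" by auto
    \<comment> \<open>The affine dependence of the three distinct numbers
      \<open>u \<bullet> p\<close>, \<open>u \<bullet> q\<close> and
      \<open>u \<bullet> r\<close>.\<close>
    define m where "m z = (if z = p then u \<bullet> q - u \<bullet> r else if z = q then u \<bullet> r - u \<bullet> p
      else u \<bullet> p - u \<bullet> q)" for z
    have m: "sum m {p, q, r} = 0" "(\<Sum>z\<in>{p, q, r}. m z * ((d *\<^sub>R u) \<bullet> z)) = 0" for d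
      using ne by (auto simp: m_def algebra_simps)
    hence "\<not> affine_on {p, q, r} (h s) (d *\<^sub>R u)" if "(\<Sum>z\<in>{p, q, r}. m z * h s z) \<noteq> 0" for s d
      using affine_sum[of "{p, q, r}" "h s" "d *\<^sub>R u" m] that by blast
    moreover have "\<forall>\<^sub>F s in at_right 0. (\<Sum>z\<in>{p, q, r}. m z * h s z) \<noteq> 0"
      by (rule generic[of _ p]) (use T in \<open>auto simp: m_def\<close>)
    ultimately show ?thesis by (auto elim: eventually_mono)
  qed
  hence ev6: "\<forall>\<^sub>F s in at_right 0. \<forall>x\<in>T.
      case x of (u, p, q, r) \<Rightarrow> \<forall>d. \<not> affine_on {p, q, r} (h s) (d *\<^sub>R u)"
    using finT by (intro eventually_ball_finite) auto
  obtain s where s1: "\<forall>q\<in>A - {a}. h s a < h s q"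
    and s2: "\<forall>p\<in>A. \<forall>q\<in>A - {p}. h s p - c p \<bullet> p < h s q - c p \<bullet> q"
    and s3: "\<forall>x\<in>?V. \<forall>q\<in>{q\<in>A. fst x \<bullet> q \<noteq> snd x}.
      h s (w x) - R x * snd x < h s q - R x * (fst x \<bullet> q)"
    and s4: "\<forall>Y\<in>{Y\<in>Pow A. affine_dependent Y}. \<forall>d. \<not> affine_on Y (h s) d"
    and s5: "\<forall>p\<in>A. \<forall>q\<in>A - {p}. h s p \<noteq> h s q"
    and s6: "\<forall>x\<in>T. case x of (u, p, q, r) \<Rightarrow> \<forall>d. \<not> affine_on {p, q, r} (h s) (d *\<^sub>R u)"
    using eventually_happens'[OF trivial_limit_at_right_real
        eventually_conj[OF ev1 eventually_conj[OF ev2 eventually_conj[OF ev3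
        eventually_conj[OF ev4 eventually_conj[OF ev5 ev6]]]]]] by blast
  have "?V \<subseteq> (SIGMA v:N. reached A (h s) a v)"
  proof
    fix x assume x: "x \<in> ?V"
    hence "fst x \<in> N" "fst x \<bullet> a < snd x" by (auto simp: reached_def)
    moreover from this have "snd x \<in> reached A (h s) a (fst x)"
      unfolding reached_def using Rw[OF x] s3 x by blast
    ultimately show "x \<in> (SIGMA v:N. reached A (h s) a v)" by (metis SigmaI prod.collapse)
  qed
  hence "card ?V \<le> card (SIGMA v:N. reached A (h s) a v)"
    using assms finite_reached[OF assms(2)] by (intro card_mono finite_SigmaI) auto
  with k have "k \<le> Suc (card (SIGMA v:N. reached A (h s) a v))" by simp
  moreover have "inj_on (h s) A" using s5 by (auto intro!: inj_onI)
  moreover have "\<not> affine_on {p, q, r} (h s) (d *\<^sub>R u)"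
    if "u \<in> N" "{p, q, r} \<subseteq> A" "u \<bullet> p \<noteq> u \<bullet> q" "u \<bullet> q \<noteq> u \<bullet> r" "u \<bullet> p \<noteq> u \<bullet> r" for u p q r d
    using bspec[OF s6, of "(u, p, q, r)"] that by (auto simp: T_def)
  ultimately show thesis
    using that[of a "h s"] a s1 s2 s4 by blast
qed

text \<open>Two minimisers on one level of \<open>u\<close> would have the same height, against
  injectivity, and on three distinct levels \<open>h\<close> would be affine with a slope along
  \<open>u\<close>.\<close>

lemma lower_direction_subset_pair:
  assumes "inj_on h A"
    and "\<And>p q r s. \<lbrakk>{p, q, r} \<subseteq> A; u \<bullet> p \<noteq> u \<bullet> q; u \<bullet> q \<noteq> u \<bullet> r; u \<bullet> p \<noteq> u \<bullet> r\<rbrakk>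
        \<Longrightarrow> \<not> affine_on {p, q, r} h (s *\<^sub>R u)"
    and pq: "p \<in> lower A h (s *\<^sub>R u)" "q \<in> lower A h (s *\<^sub>R u)" "p \<noteq> q"
  shows "u \<bullet> p \<noteq> u \<bullet> q" "lower A h (s *\<^sub>R u) = {p, q}"
proof -
  have ne: "u \<bullet> x \<noteq> u \<bullet> y" if "x \<in> lower A h (s *\<^sub>R u)" "y \<in> lower A h (s *\<^sub>R u)" "x \<noteq> y" for x y
    using lower_eq[OF that(1,2)] that assms(1) lower_subset[of A h "s *\<^sub>R u"]
    by (auto simp: inj_on_eq_iff subset_iff)
  thus "u \<bullet> p \<noteq> u \<bullet> q" using pq by blast
  show "lower A h (s *\<^sub>R u) = {p, q}"
  proof (rule ccontr)
    assume "lower A h (s *\<^sub>R u) \<noteq> {p, q}"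
    then obtain r where r: "r \<in> lower A h (s *\<^sub>R u)" "r \<noteq> p" "r \<noteq> q" using pq by blast
    have "{p, q, r} \<subseteq> lower A h (s *\<^sub>R u)" using pq r by blast
    hence "affine_on {p, q, r} h (s *\<^sub>R u)" "{p, q, r} \<subseteq> A"
      using affine_on_lower[of A h "s *\<^sub>R u"] lower_subset by (auto simp: affine_on_def)
    thus False using assms(2)[of p q r s] ne[OF pq] ne[OF pq(1) r(1)] ne[OF pq(2) r(1)] r by metis
  qed
qed

text \<open>The edge through which the ray \<open>\<lambda>s. s *\<^sub>R u\<close> first reaches the level \<open>t\<close>.\<close>

lemma reached_edge:
  assumes A: "finite A" "a \<in> A" "\<And>q. q \<in> A - {a} \<Longrightarrow> h a < h q" and t: "t \<in> reached A h a u"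
  shows "\<exists>s>0. \<exists>p q. p \<in> lower A h (s *\<^sub>R u) \<and> q \<in> lower A h (s *\<^sub>R u) \<and> u \<bullet> p = t \<and> u \<bullet> q < t"
proof -
  obtain r p' where r: "r > 0" "p' \<in> A" "u \<bullet> p' = t" "u \<bullet> a < t"
    "\<And>q. q \<in> A \<Longrightarrow> u \<bullet> q \<noteq> t \<Longrightarrow> h p' - r * t < h q - r * (u \<bullet> q)"
    using t by (auto simp: reached_def)
  let ?E = "{q \<in> A. u \<bullet> q = t}" and ?D = "{q \<in> A. u \<bullet> q < t}"
  have "Min (h ` ?E) \<in> h ` ?E" using A(1) r by (intro Min_in) auto
  then obtain p where p: "p \<in> ?E" "h p = Min (h ` ?E)" by auto
  hence p_min: "h p \<le> h q" if "q \<in> ?E" for q using that A(1) by auto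
  have pr: "h p - r * t < h q - r * (u \<bullet> q)" if "q \<in> A" "u \<bullet> q \<noteq> t" for q
    using r(5)[OF that] p_min[of p'] r by simp
  \<comment> \<open>\<open>g q\<close> is the parameter at which \<open>p\<close> and
    \<open>q\<close> tie. From the largest such value on, \<open>p\<close> is at least as good as
    every point on a lower level.\<close>
  define g where "g q = (h p - h q) / (t - u \<bullet> q)" for q
  have "Max (g ` ?D) \<in> g ` ?D" using A r by (intro Max_in) auto
  then obtain q where q: "q \<in> ?D" "g q = Max (g ` ?D)" by auto
  define s where "s = g q"
  have s_max: "g z \<le> s" if "z \<in> ?D" for z using that A(1) q s_def by auto
  have "p \<in> A - {a}" using p(1) r(4) by auto
  hence "0 < g a" using A(3)[of p] p(1) r(4) unfolding g_def by (intro divide_pos_pos) auto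
  hence "0 < s" using s_max[of a] A r by auto
  \<comment> \<open>Points above level \<open>t\<close> are worse than \<open>p\<close> at slope
    \<open>r\<close>, and therefore also at the smaller slope \<open>s\<close>.\<close>
  have "s < r" using pr[of q] q(1) unfolding s_def g_def
    by (auto simp: pos_divide_less_eq algebra_simps)
  have le: "h p - s * t \<le> h z - s * (u \<bullet> z)" if z: "z \<in> A" for z
  proof (cases "u \<bullet> z" t rule: linorder_cases)
    case less
    thus ?thesis using s_max[of z] z by (simp add: g_def pos_divide_le_eq algebra_simps)
  next
    case equal
    thus ?thesis using p_min z by simp
  next
    case greater
    have "s * (u \<bullet> z - t) \<le> r * (u \<bullet> z - t)" using greater \<open>s < r\<close> by (intro mult_right_mono) auto
    thus ?thesis using pr[OF z] greater by (simp add: algebra_simps)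
  qed
  have eq: "h q - s * (u \<bullet> q) = h p - s * t"
    using q(1) unfolding s_def g_def by (simp add: field_simps)
  have "p \<in> lower A h (s *\<^sub>R u)" "q \<in> lower A h (s *\<^sub>R u)"
    using le eq p q by (auto simp: lower_def)
  thus ?thesis using \<open>0 < s\<close> p q by blast
qed

section \<open>Counting triangles\<close>

text \<open>Rotation by a right angle; \<open>perp x \<bullet> y\<close> is the determinant of
  \<open>x\<close> and \<open>y\<close>, so its sign is their orientation.\<close>

definition perp :: "real^2 \<Rightarrow> real^2" where
  "perp x = vector [- x$2, x$1]"

lemma perp_component [simp]: "perp x $ 1 = - x$2" "perp x $ 2 = x$1"
  by (simp_all add: perp_def)

lemma inner_2: "(x::real^2) \<bullet> y = x$1 * y$1 + x$2 * y$2"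
  by (simp add: inner_vec_def sum_2)

lemma inner_zero_imp_perp:
  assumes "e \<noteq> 0" "e \<bullet> x = 0"
  shows "x = ((perp e \<bullet> x) / (e \<bullet> e)) *\<^sub>R perp e"
proof -
  have ee: "e \<bullet> e \<noteq> 0" using assms by simp
  have z: "e$1 * x$1 + e$2 * x$2 = 0" using assms(2) by (simp add: inner_2)
  have "x$1 * (e \<bullet> e) = (perp e \<bullet> x) * (- e$2)" "x$2 * (e \<bullet> e) = (perp e \<bullet> x) * e$1"
    using z by (simp_all add: inner_2) algebra+
  hence "x$1 = (perp e \<bullet> x) * (- e$2) / (e \<bullet> e)" "x$2 = (perp e \<bullet> x) * e$1 / (e \<bullet> e)"
    using ee by (metis nonzero_mult_div_cancel_right)+
  thus ?thesis by (simp add: vec_eq_iff forall_2)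
qed

lemma exists_inj_on_inner:
  fixes A :: "(real^2) set"
  assumes "finite A"
  shows "\<exists>e. e \<noteq> 0 \<and> inj_on ((\<bullet>) e) A"
proof -
  \<comment> \<open>The values of \<open>s\<close> at which two points tie. Pairs with equal second
    coordinates only add the value 0, from division by zero.\<close>
  let ?Z = "(\<lambda>(p, q). - (p$1 - q$1) / (p$2 - q$2)) ` (A \<times> A)"
  have "finite ?Z" using assms by simp
  then obtain s where s: "s \<notin> ?Z" using ex_new_if_finite[OF infinite_UNIV_char_0] by blast
  let ?e = "vector [1, s] :: real^2"
  have "p = q" if "p \<in> A" "q \<in> A" "?e \<bullet> p = ?e \<bullet> q" for p q
  proof -
    have eq: "p$1 - q$1 + s * (p$2 - q$2) = 0" using that(3) by (simp add: inner_2 algebra_simps)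
    have "p$2 = q$2"
    proof (rule ccontr)
      assume "p$2 \<noteq> q$2"
      hence "s = - (p$1 - q$1) / (p$2 - q$2)" using eq by (simp add: field_simps)
      thus False using s that by force
    qed
    thus ?thesis using eq by (simp add: vec_eq_iff forall_2)
  qed
  moreover have "?e \<noteq> 0" by (simp add: vec_eq_iff forall_2)
  ultimately show ?thesis by (intro exI[of _ ?e]) (auto intro!: inj_onI)
qed

text \<open>The line orthogonal to \<open>e\<close> through the middle vertex \<open>p\<close> meets
  the opposite edge in a point \<open>w\<close>, and the open segment from \<open>p\<close> to
  \<open>w\<close> lies inside. The sign of \<open>d\<close> records on which side of
  \<open>p\<close> it runs.\<close>

lemma triangle_middle_vertex:
  fixes C :: "(real^2) set"
  assumes e: "e \<noteq> 0" "inj_on ((\<bullet>) e) C" and C: "\<not> affine_dependent C" "card C = 3"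
  shows "\<exists>p\<in>C. \<exists>d. d \<noteq> 0 \<and> (\<exists>q\<in>C. e \<bullet> q < e \<bullet> p) \<and> (\<exists>r\<in>C. e \<bullet> p < e \<bullet> r) \<and>
    (\<forall>t. 0 < t \<and> t < 1 \<longrightarrow> p + (t * d) *\<^sub>R perp e \<in> rel_interior (convex hull C))"
proof -
  obtain x y z where xyz: "C = {x, y, z}" "x \<noteq> y" "y \<noteq> z" "x \<noteq> z"
    using C(2) unfolding card_3_iff by blast
  hence "e \<bullet> x \<noteq> e \<bullet> y" "e \<bullet> y \<noteq> e \<bullet> z" "e \<bullet> x \<noteq> e \<bullet> z"
    using e(2) by (auto simp: inj_on_def)
  then consider "e \<bullet> x < e \<bullet> y" "e \<bullet> y < e \<bullet> z" | "e \<bullet> x < e \<bullet> z" "e \<bullet> z < e \<bullet> y"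
    | "e \<bullet> y < e \<bullet> x" "e \<bullet> x < e \<bullet> z" | "e \<bullet> y < e \<bullet> z" "e \<bullet> z < e \<bullet> x"
    | "e \<bullet> z < e \<bullet> x" "e \<bullet> x < e \<bullet> y" | "e \<bullet> z < e \<bullet> y" "e \<bullet> y < e \<bullet> x"
    by linarith
  hence "\<exists>q p r. {x, y, z} = {q, p, r} \<and> e \<bullet> q < e \<bullet> p \<and> e \<bullet> p < e \<bullet> r"
  proof cases
    case 1 thus ?thesis by (intro exI[of _ x] exI[of _ y] exI[of _ z]) auto
  next
    case 2 thus ?thesis by (intro exI[of _ x] exI[of _ z] exI[of _ y]) auto
  next
    case 3 thus ?thesis by (intro exI[of _ y] exI[of _ x] exI[of _ z]) auto
  next
    case 4 thus ?thesis by (intro exI[of _ y] exI[of _ z] exI[of _ x]) auto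
  next
    case 5 thus ?thesis by (intro exI[of _ z] exI[of _ x] exI[of _ y]) auto
  next
    case 6 thus ?thesis by (intro exI[of _ z] exI[of _ y] exI[of _ x]) auto
  qed
  then obtain q p r where qpr: "C = {q, p, r}" "e \<bullet> q < e \<bullet> p" "e \<bullet> p < e \<bullet> r"
    using xyz(1) by blast
  hence ne: "q \<noteq> p" "p \<noteq> r" "q \<noteq> r" by auto
  \<comment> \<open>This puts \<open>w\<close> on the \<open>e\<close>-level of
    \<open>p\<close>.\<close>
  define s where "s = (e \<bullet> p - e \<bullet> q) / (e \<bullet> r - e \<bullet> q)"
  have s: "0 < s" "s < 1" using qpr by (auto simp: s_def)
  define w where "w = (1 - s) *\<^sub>R q + s *\<^sub>R r"
  have "s * (e \<bullet> r - e \<bullet> q) = e \<bullet> p - e \<bullet> q" using qpr by (simp add: s_def)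
  hence ew: "e \<bullet> (w - p) = 0" by (simp add: w_def inner_diff_right inner_add_right algebra_simps)
  define d where "d = (perp e \<bullet> (w - p)) / (e \<bullet> e)"
  have wd: "w - p = d *\<^sub>R perp e" unfolding d_def by (rule inner_zero_imp_perp[OF e(1) ew])
  have int: "p + t *\<^sub>R (w - p) \<in> rel_interior (convex hull C)" if t: "0 < t" "t < 1" for t
  proof -
    define m where "m v = (if v = p then 1 - t else if v = q then t * (1 - s) else t * s)" for v
    have "\<forall>v\<in>C. 0 < m v" using t s by (auto simp: m_def qpr(1))
    moreover have "sum m C = 1" using ne by (simp add: m_def qpr(1) algebra_simps)
    moreover have "(\<Sum>v\<in>C. m v *\<^sub>R v) = p + t *\<^sub>R (w - p)"
      using ne by (simp add: m_def qpr(1) w_def algebra_simps)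
    ultimately show ?thesis unfolding rel_interior_convex_hull_explicit[OF C(1)] by blast
  qed
  have "w \<noteq> p"
  proof
    assume "w = p"
    hence "p \<in> convex hull {q, r}" using s w_def
      by (auto simp: segment_convex_hull[symmetric] in_segment intro!: exI[of _ s])
    moreover have "convex hull {q, r} \<subseteq> affine hull (C - {p})"
      using ne qpr(1) convex_hull_subset_affine_hull[of "{q, r}"] hull_mono[of "{q, r}" "C - {p}" affine]
      by auto
    ultimately show False using C(1) qpr(1) unfolding affine_dependent_def by blast
  qed
  hence "d \<noteq> 0" using wd by auto
  moreover have "\<forall>t. 0 < t \<and> t < 1 \<longrightarrow> p + (t * d) *\<^sub>R perp e \<in> rel_interior (convex hull C)"
    using int wd by (simp flip: scaleR_scaleR)
  ultimately show ?thesis using qpr by blast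
qed

text \<open>A face that meets the relative interior is the whole set.\<close>

lemma rel_interior_Int_imp_eq:
  fixes F G :: "'a::euclidean_space set"
  assumes "(F \<inter> G) face_of F" "(G \<inter> F) face_of G" "x \<in> rel_interior F" "x \<in> rel_interior G"
  shows "F = G"
proof -
  have x: "x \<in> F \<inter> G" using assms(3,4) rel_interior_subset[of F] rel_interior_subset[of G] by blast
  have "F \<inter> G = F"
    using face_of_disjoint_rel_interior[OF assms(1)] x assms(3) by (metis disjoint_iff)
  moreover have "G \<inter> F = G"
    using face_of_disjoint_rel_interior[OF assms(2)] x assms(4) by (metis disjoint_iff Int_commute)
  ultimately show ?thesis by blast
qed

text \<open>Order the points by a generic functional \<open>e\<close>. On either side of the line orthogonal to \<open>e\<close> through
  a point, at most one triangle has the point as its middle vertex. The first and the last point are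
  never in the middle, and a point of a top face loses the side that leaves the hull.\<close>

lemma card_triangles_le:
  assumes T: "triangulation_of T A" and A: "finite A" "2 \<le> card A" and U: "0 \<notin> U"
  shows "card (triangles T) + card (\<Union>u\<in>U. top_face u A) + 2 \<le> 2 * card A"
proof -
  let ?X = "\<Union>u\<in>U. top_face u A"
  obtain e where e: "e \<noteq> 0" "inj_on ((\<bullet>) e) A" using exists_inj_on_inner[OF A(1)] by blast
  have sc: "simplicial_complex T" and UT: "\<Union>T = convex hull A" and vert: "{v. {v} \<in> T} = A"
    using T by (auto simp: triangulation_of_def)
  define Mid where "Mid F p d \<longleftrightarrow> p \<in> A \<and> d \<noteq> 0 \<and> (\<exists>q\<in>A. e \<bullet> q < e \<bullet> p) \<and> (\<exists>r\<in>A. e \<bullet> p < e \<bullet> r) \<and>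
    (\<forall>t. 0 < t \<and> t < 1 \<longrightarrow> p + (t * d) *\<^sub>R perp e \<in> rel_interior F)" for F p d
  have "\<exists>x. Mid F (fst x) (snd x)" if F: "F \<in> triangles T" for F
  proof -
    obtain C where C: "\<not> affine_dependent C" "card C = 3" "F = convex hull C"
      using F by (auto simp: triangles_def simplex_def)
    have "C \<subseteq> A"
    proof
      fix v assume "v \<in> C"
      hence "{v} face_of F"
        using C by (simp add: face_of_singleton extreme_point_of_convex_hull_affine_independent)
      hence "{v} \<in> T" using sc F unfolding simplicial_complex_def triangles_def by blast
      thus "v \<in> A" using vert by blast
    qed
    with triangle_middle_vertex[OF e(1) inj_on_subset[OF e(2) this] C(1,2)] C(3)
    have "\<exists>p d. Mid F p d" unfolding Mid_def by blast
    thus ?thesis by auto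
  qed
  then obtain M where M: "\<And>F. F \<in> triangles T \<Longrightarrow> Mid F (fst (M F)) (snd (M F))" by metis
  \<comment> \<open>Middle vertex and side: two possible values for each point of \<open>A\<close>,
    which is where \<open>2 * card A\<close> comes from.\<close>
  define \<phi> where "\<phi> F = (fst (M F), 0 < snd (M F))" for F
  have inj: "inj_on \<phi> (triangles T)"
  proof (rule inj_onI)
    fix F G assume F: "F \<in> triangles T" and G: "G \<in> triangles T" and eq: "\<phi> F = \<phi> G"
    define p d d' where "p = fst (M F)" and "d = snd (M F)" and "d' = snd (M G)"
    have MF: "Mid F p d" and MG: "Mid G p d'"
      using M[OF F] M[OF G] eq by (simp_all add: \<phi>_def p_def d_def d'_def)
    have dd: "d \<noteq> 0" "d' \<noteq> 0" "0 < d \<longleftrightarrow> 0 < d'"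
      using MF MG eq by (simp_all add: Mid_def \<phi>_def d_def d'_def)
    \<comment> \<open>Half of the shorter segment, with its sign, so that the point at
      \<open>k\<close> is on both segments.\<close>
    define k where "k = (if 0 < d then min d d' / 2 else max d d' / 2)"
    have k: "0 < k / d" "k / d < 1" "0 < k / d'" "k / d' < 1"
      using dd by (auto simp: k_def divide_simps split: if_splits)
    have "p + k *\<^sub>R perp e \<in> rel_interior F" "p + k *\<^sub>R perp e \<in> rel_interior G"
      using MF MG k dd unfolding Mid_def by (metis nonzero_eq_divide_eq)+
    thus "F = G"
      using sc F G unfolding simplicial_complex_def triangles_def
      by (intro rel_interior_Int_imp_eq) auto
  qed
  define u where "u p = (SOME u. u \<in> U \<and> p \<in> top_face u A)" for p
  have u: "u p \<in> U \<and> p \<in> top_face (u p) A" if "p \<in> ?X" for p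
    unfolding u_def by (rule someI_ex) (use that in blast)
  \<comment> \<open>The side on which the line leaves the hull at \<open>p\<close>. If
    \<open>u p\<close> is parallel to \<open>e\<close> the value is arbitrary: then \<open>p\<close>
    is extreme for \<open>e\<close> and never a middle vertex.\<close>
  define s where "s p \<longleftrightarrow> 0 < u p \<bullet> perp e" for p
  obtain a b where a: "a \<in> top_face (- e) A" and b: "b \<in> top_face e A"
    using top_face_nonempty[OF A(1)] A(2) by (metis card.empty ex_in_conv not_numeral_le_zero)
  have "a \<noteq> b"
  proof
    assume "a = b"
    have "q = a" if "q \<in> A" for q
    proof -
      have "e \<bullet> q \<le> e \<bullet> a" "e \<bullet> a \<le> e \<bullet> q" using a b that \<open>a = b\<close> by (auto simp: top_face_def)
      thus ?thesis using e(2) that a by (auto simp: inj_on_def top_face_def)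
    qed
    hence "A \<subseteq> {a}" by blast
    from card_mono[OF _ this] A(2) show False by simp
  qed
  \<comment> \<open>Pairs missed by the injection. As \<open>a\<close> and \<open>b\<close> may lie
    on top faces, \<open>?D2\<close> takes their opposite sides and so stays disjoint from
    \<open>?D1\<close>.\<close>
  let ?D1 = "(\<lambda>p. (p, s p)) ` ?X" and ?D2 = "(\<lambda>p. (p, \<not> s p)) ` {a, b}"
  have Xfin: "finite ?X" and XA: "?X \<subseteq> A"
    using top_face_subset A(1) by (auto intro: finite_subset[of _ A])
  have D1: "\<phi> F \<notin> ?D1" if F: "F \<in> triangles T" for F
  proof
    assume "\<phi> F \<in> ?D1"
    then obtain p where p: "p \<in> ?X" "\<phi> F = (p, s p)" by blast
    define d where "d = snd (M F)"
    have Mid: "Mid F p d" "0 < d \<longleftrightarrow> s p" using M[OF F] p(2) by (simp_all add: \<phi>_def d_def)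
    have "\<forall>t. 0 < t \<and> t < 1 \<longrightarrow> p + (t * d) *\<^sub>R perp e \<in> rel_interior F"
      using Mid(1) unfolding Mid_def by blast
    from this[rule_format, of "1/2"] have "p + (1/2 * d) *\<^sub>R perp e \<in> rel_interior F" by simp
    hence "p + (1/2 * d) *\<^sub>R perp e \<in> convex hull A"
      using F UT rel_interior_subset[of F] unfolding triangles_def by blast
    moreover have "convex hull A \<subseteq> {x. u p \<bullet> x \<le> u p \<bullet> p}"
      using u[OF p(1)] by (intro hull_minimal convex_halfspace_le) (auto simp: top_face_def)
    ultimately have "u p \<bullet> (p + (1/2 * d) *\<^sub>R perp e) \<le> u p \<bullet> p" by blast
    hence le: "d * (u p \<bullet> perp e) \<le> 0" by (simp add: inner_add_right)
    have "u p \<bullet> perp e = 0"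
      using le Mid unfolding s_def Mid_def by (auto simp: mult_le_0_iff)
    hence "perp e \<bullet> u p = 0" by (simp add: inner_commute)
    moreover have "perp e \<noteq> 0" using e(1) by (auto simp: vec_eq_iff forall_2)
    ultimately have up: "u p = ((perp (perp e) \<bullet> u p) / (perp e \<bullet> perp e)) *\<^sub>R perp (perp e)"
      by (intro inner_zero_imp_perp)
    have "perp (perp e) = - e" by (simp add: vec_eq_iff forall_2)
    with up obtain c where c: "u p = c *\<^sub>R e" by (metis scaleR_minus_left scaleR_minus_right)
    obtain q r where qr: "q \<in> A" "e \<bullet> q < e \<bullet> p" "r \<in> A" "e \<bullet> p < e \<bullet> r"
      using Mid(1) unfolding Mid_def by blast
    have "c * (e \<bullet> q) \<le> c * (e \<bullet> p)" "c * (e \<bullet> r) \<le> c * (e \<bullet> p)"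
      using u[OF p(1)] qr by (auto simp: top_face_def c)
    hence "c = 0" using qr by (smt (verit) mult_le_cancel_left)
    thus False using u[OF p(1)] U c by simp
  qed
  have D2: "\<phi> F \<notin> ?D2" if F: "F \<in> triangles T" for F
  proof -
    obtain q r where "q \<in> A" "e \<bullet> q < e \<bullet> fst (M F)" "r \<in> A" "e \<bullet> fst (M F) < e \<bullet> r"
      using M[OF F] unfolding Mid_def by blast
    hence "fst (M F) \<noteq> a" "fst (M F) \<noteq> b" using a b by (auto simp: top_face_def)
    thus ?thesis by (auto simp: \<phi>_def)
  qed
  have "card (triangles T) + (card ?X + 2) = card (\<phi> ` triangles T) + (card ?D1 + card ?D2)"
    using \<open>a \<noteq> b\<close> card_image[OF inj] by (simp add: card_image inj_on_def)
  also have "card ?D1 + card ?D2 = card (?D1 \<union> ?D2)"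
    using Xfin by (intro card_Un_disjoint[symmetric]) auto
  also have "card (\<phi> ` triangles T) + card (?D1 \<union> ?D2) = card (\<phi> ` triangles T \<union> (?D1 \<union> ?D2))"
  proof (rule card_Un_disjoint[symmetric])
    have "finite (triangles T)" using sc by (simp add: simplicial_complex_def triangles_def)
    thus "finite (\<phi> ` triangles T)" by (rule finite_imageI)
    show "\<phi> ` triangles T \<inter> (?D1 \<union> ?D2) = {}" using D1 D2 by blast
  qed (use Xfin in simp)
  also have "\<dots> \<le> card (A \<times> (UNIV :: bool set))"
  proof (rule card_mono)
    show "finite (A \<times> (UNIV :: bool set))" using A by simp
    have "a \<in> A" "b \<in> A" using a b by (auto simp: top_face_def)
    moreover have "fst (M F) \<in> A" if "F \<in> triangles T" for F using M[OF that] by (simp add: Mid_def)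
    ultimately show "\<phi> ` triangles T \<union> (?D1 \<union> ?D2) \<subseteq> A \<times> UNIV"
      using XA by (auto simp: \<phi>_def)
  qed
  also have "\<dots> = 2 * card A" by (simp add: card_cartesian_product)
  finally show ?thesis by simp
qed

section \<open>The directions of a triangle\<close>

lemma lower_zero: "lower B (\<lambda>_. 0) c = top_face c B"
  by (simp add: lower_def top_face_def)

lemma top_face_0: "top_face 0 B = B"
  by (simp add: top_face_def)

text \<open>A negative determinant places \<open>x\<close> on the inner side, so
  \<open>perp (y - z)\<close> is an outer normal of the edge from \<open>y\<close> to
  \<open>z\<close>, and it spans the normal cone of that edge.\<close>

lemma edge_direction:
  fixes x y z :: "real^2"
  assumes D: "perp (y - z) \<bullet> (x - z) < 0"
  shows "s > 0 \<Longrightarrow> top_face (s *\<^sub>R perp (y - z)) {x, y, z} = {y, z}"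
    and "\<lbrakk>c \<noteq> 0; c \<bullet> y = c \<bullet> z; c \<bullet> x \<le> c \<bullet> z\<rbrakk> \<Longrightarrow> \<exists>s>0. c = s *\<^sub>R perp (y - z)"
proof -
  have yz: "perp (y - z) \<bullet> y = perp (y - z) \<bullet> z" by (simp add: inner_2 algebra_simps)
  have x: "perp (y - z) \<bullet> x < perp (y - z) \<bullet> z" using D by (simp add: inner_diff_right)
  show "top_face (s *\<^sub>R perp (y - z)) {x, y, z} = {y, z}" if "s > 0"
    using that yz x by (auto simp: top_face_def)
  show "\<exists>s>0. c = s *\<^sub>R perp (y - z)" if c: "c \<noteq> 0" "c \<bullet> y = c \<bullet> z" "c \<bullet> x \<le> c \<bullet> z"
  proof -
    define s where "s = (perp (y - z) \<bullet> c) / ((y - z) \<bullet> (y - z))"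
    have "y - z \<noteq> 0" using D by (auto simp: inner_2)
    moreover have "(y - z) \<bullet> c = 0" using c(2) by (simp add: inner_diff_right inner_commute[of _ c])
    ultimately have cs: "c = s *\<^sub>R perp (y - z)" unfolding s_def by (rule inner_zero_imp_perp)
    have "s * (perp (y - z) \<bullet> (x - z)) \<le> 0"
      using c(3) by (simp add: cs inner_diff_right right_diff_distrib)
    hence "s \<ge> 0" using D by (simp add: mult_le_0_iff)
    moreover have "s \<noteq> 0" using c(1) cs by auto
    ultimately show ?thesis using cs by (intro exI[of _ s]) auto
  qed
qed

lemma inner_perp_inj:
  assumes "perp u \<bullet> v \<noteq> 0" "u \<bullet> p = u \<bullet> q" "v \<bullet> p = v \<bullet> q"
  shows "p = q"
proof -
  have u: "u \<noteq> 0" using assms(1) by (auto simp: inner_2)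
  define t where "t = (perp u \<bullet> (p - q)) / (u \<bullet> u)"
  have pq: "p - q = t *\<^sub>R perp u"
    unfolding t_def by (rule inner_zero_imp_perp[OF u]) (use assms in \<open>simp add: inner_diff_right\<close>)
  have "v \<bullet> (p - q) = 0" using assms by (simp add: inner_diff_right)
  hence "t * (perp u \<bullet> v) = 0" by (simp add: pq inner_commute)
  thus ?thesis using assms(1) pq by simp
qed

text \<open>A nonzero functional is maximal at a single vertex of the triangle unless it is an outer
  normal of an edge; \<open>N\<close> collects these normals.\<close>

lemma exists_edge_directions:
  fixes B :: "(real^2) set"
  assumes "card B = 3" "\<not> collinear B"
  obtains N where "three_directions N"
    "\<And>c. c \<noteq> 0 \<Longrightarrow> (\<exists>b. top_face c B = {b}) \<or> (\<exists>u\<in>N. \<exists>s>0. c = s *\<^sub>R u)"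
    "\<And>u s. \<lbrakk>u \<in> N; s > 0\<rbrakk> \<Longrightarrow> \<exists>b b'. b \<noteq> b' \<and> top_face (s *\<^sub>R u) B = {b, b'}"
proof -
  obtain x y z where B: "B = {x, y, z}" "x \<noteq> y" "y \<noteq> z" "x \<noteq> z"
    using assms(1) unfolding card_3_iff by blast
  have ne0: "perp (y - z) \<bullet> (x - z) \<noteq> 0"
  proof
    assume 0: "perp (y - z) \<bullet> (x - z) = 0"
    have yz: "perp (y - z) \<noteq> 0" using B by (auto simp: vec_eq_iff forall_2)
    have pp: "perp (perp (y - z)) = - (y - z)" by (simp add: vec_eq_iff forall_2)
    from inner_zero_imp_perp[OF yz 0] obtain t where "x - z = t *\<^sub>R (y - z)"
      unfolding pp by (metis scaleR_minus_left scaleR_minus_right)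
    hence "x = t *\<^sub>R y + (1 - t) *\<^sub>R z" by (simp add: algebra_simps)
    hence "collinear {y, x, z}" unfolding collinear_3_expand by blast
    thus False using assms(2) B by (simp add: insert_commute)
  qed
  have flip: "perp (z - y) \<bullet> (x - y) = - (perp (y - z) \<bullet> (x - z))"
    by (simp add: inner_2 algebra_simps)
  have swap: "{x, z, y} = {x, y, z}" by auto
  \<comment> \<open>Exchanging \<open>y\<close> and \<open>z\<close> reverses the orientation, so
    one of the two orders has a negative determinant.\<close>
  have "\<exists>y' z'. B = {x, y', z'} \<and> perp (y' - z') \<bullet> (x - z') < 0"
    unfolding B(1)
  proof (cases "perp (y - z) \<bullet> (x - z) < 0")
    case True
    thus "\<exists>y' z'. {x, y, z} = {x, y', z'} \<and> perp (y' - z') \<bullet> (x - z') < 0" by blast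
  next
    case False
    hence "perp (z - y) \<bullet> (x - y) < 0" using flip ne0 by linarith
    thus "\<exists>y' z'. {x, y, z} = {x, y', z'} \<and> perp (y' - z') \<bullet> (x - z') < 0"
      using swap by (intro exI[of _ z] exI[of _ y]) simp
  qed
  then obtain y' z' where B': "B = {x, y', z'}" "perp (y' - z') \<bullet> (x - z') < 0" by blast
  define D where "D = perp (y' - z') \<bullet> (x - z')"
  \<comment> \<open>The determinant is invariant under cyclic shifts, so all three normals point
    outwards at once.\<close>
  have D: "D < 0" "perp (y' - z') \<bullet> (x - z') = D" "perp (z' - x) \<bullet> (y' - x) = D"
    "perp (x - y') \<bullet> (z' - y') = D"
    using B'(2) by (simp_all add: D_def inner_2 algebra_simps)
  define N where "N = {perp (y' - z'), perp (z' - x), perp (x - y')}"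
  have cross: "perp (perp (y' - z')) \<bullet> perp (z' - x) = - D" "perp (perp (z' - x)) \<bullet> perp (x - y') = - D"
    "perp (perp (x - y')) \<bullet> perp (y' - z') = - D"
    by (simp_all add: D_def inner_2 algebra_simps)
  have anti: "perp a \<bullet> b = - (perp b \<bullet> a)" for a b by (simp add: inner_2)
  have self: "perp a \<bullet> a = 0" for a by (simp add: inner_2)
  have ne: "perp (y' - z') \<noteq> perp (z' - x)" "perp (z' - x) \<noteq> perp (x - y')"
    "perp (x - y') \<noteq> perp (y' - z')"
    using cross D(1) self by (metis neg_equal_0_iff_equal order_less_irrefl)+
  have cross': "perp u \<bullet> v \<noteq> 0" if "u \<in> N" "v \<in> N" "u \<noteq> v" for u v
    using that cross D(1) anti[of "perp (z' - x)" "perp (y' - z')"]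
      anti[of "perp (x - y')" "perp (z' - x)"] anti[of "perp (y' - z')" "perp (x - y')"]
    unfolding N_def by auto
  have "three_directions N"
  proof
    show "card N = 3" using ne by (auto simp: N_def)
    have "\<Sum>N = perp (y' - z') + perp (z' - x) + perp (x - y')"
      using ne by (simp add: N_def add.assoc)
    thus "\<Sum>N = 0" by (simp add: vec_eq_iff forall_2)
    show "p = q" if "u \<in> N" "v \<in> N" "u \<noteq> v" "u \<bullet> p = u \<bullet> q" "v \<bullet> p = v \<bullet> q" for u v p q
      using cross'[OF that(1-3)] that(4,5) by (rule inner_perp_inj)
  qed
  moreover have "(\<exists>b. top_face c B = {b}) \<or> (\<exists>u\<in>N. \<exists>s>0. c = s *\<^sub>R u)" if c: "c \<noteq> 0" for c
  proof -
    consider "c \<bullet> y' < c \<bullet> x" "c \<bullet> z' < c \<bullet> x" | "c \<bullet> x < c \<bullet> y'" "c \<bullet> z' < c \<bullet> y'"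
      | "c \<bullet> x < c \<bullet> z'" "c \<bullet> y' < c \<bullet> z'" | "c \<bullet> y' = c \<bullet> z'" "c \<bullet> x \<le> c \<bullet> z'"
      | "c \<bullet> z' = c \<bullet> x" "c \<bullet> y' \<le> c \<bullet> x" | "c \<bullet> x = c \<bullet> y'" "c \<bullet> z' \<le> c \<bullet> y'"
      by linarith
    thus ?thesis
    proof cases
      case 1
      hence "top_face c B = {x}" unfolding B'(1) top_face_def by auto
      thus ?thesis by blast
    next
      case 2
      hence "top_face c B = {y'}" unfolding B'(1) top_face_def by auto
      thus ?thesis by blast
    next
      case 3
      hence "top_face c B = {z'}" unfolding B'(1) top_face_def by auto
      thus ?thesis by blast
    next
      case 4
      thus ?thesis using edge_direction(2)[of y' z' x c] D c unfolding N_def by auto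
    next
      case 5
      thus ?thesis using edge_direction(2)[of z' x y' c] D c unfolding N_def by auto
    next
      case 6
      thus ?thesis using edge_direction(2)[of x y' z' c] D c unfolding N_def by auto
    qed
  qed
  moreover have "\<exists>b b'. b \<noteq> b' \<and> top_face (s *\<^sub>R u) B = {b, b'}" if u: "u \<in> N" and s: "s > 0" for u s
  proof -
    have ne: "x \<noteq> y'" "y' \<noteq> z'" "x \<noteq> z'" using D by (auto simp: inner_2)
    have "B = {y', z', x}" "B = {z', x, y'}" using B' by auto
    hence "top_face (s *\<^sub>R perp (y' - z')) B = {y', z'}" "top_face (s *\<^sub>R perp (z' - x)) B = {z', x}"
      "top_face (s *\<^sub>R perp (x - y')) B = {x, y'}"
      using edge_direction(1)[of y' z' x s] edge_direction(1)[of z' x y' s]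
        edge_direction(1)[of x y' z' s] D B'(1) s by simp_all
    thus ?thesis using u ne unfolding N_def by (metis empty_iff insert_iff)
  qed
  ultimately show thesis using that by blast
qed

section \<open>Regular subdivisions and triangulations in the plane\<close>

lemma not_collinear_imp_interior:
  fixes P :: "(real^2) set"
  assumes "\<not> collinear P"
  shows "interior (convex hull P) \<noteq> {}"
proof -
  have "aff_dim P = DIM(real^2)"
    using assms aff_dim_le_DIM[of P] by (simp add: collinear_aff_dim)
  hence "affine hull (convex hull P) = UNIV" by (metis aff_dim_convex_hull aff_dim_eq_full)
  hence "rel_interior (convex hull P) = interior (convex hull P)" by (rule rel_interior_interior)
  moreover have "P \<noteq> {}" using assms by auto
  ultimately show ?thesis using rel_interior_eq_empty[of "convex hull P"] by auto
qed

lemma polygonal_subdivision_cells: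
  assumes "finite P" "\<not> collinear P"
  shows "polygonal_subdivision (range (cell P h)) (convex hull P)"
proof -
  have ne: "P \<noteq> {}" using assms by auto
  have "(cell P h c \<inter> cell P h c') face_of cell P h c'" for c c'
    using cell_Int_cell[OF assms(1) ne, of h c' c] by (simp add: Int_commute)
  moreover have "polytope (cell P h c)" "cell P h c \<noteq> {}" for c
    using assms(1) lower_nonempty[OF assms(1) ne] by (simp_all add: cell_def polytope_convex_hull)
  ultimately show ?thesis
    unfolding polygonal_subdivision_def
  proof (intro conjI ballI allI impI)
    show "finite (range (cell P h))" by (rule finite_range_cell[OF assms(1)])
    show "\<Union>(range (cell P h)) = convex hull P"
      by (rule Union_cells[OF assms(1) not_collinear_imp_interior[OF assms(2)]])
    show "L \<in> range (cell P h)" if "K \<in> range (cell P h)" "L face_of K \<and> L \<noteq> {}" for K L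
      using that face_of_cell[OF assms(1)] by blast
  qed (use cell_Int_cell[OF assms(1) ne] in auto)
qed

text \<open>Affine independence turns the cells into simplices, and \<open>vert\<close> makes every
  point of \<open>A\<close> a vertex. The empty set is inserted because a simplicial complex
  contains all faces, including the empty one.\<close>

lemma triangulation_of_cells:
  assumes A: "finite A" "\<not> collinear A"
    and indep: "\<And>c. \<not> affine_dependent (lower A h c)"
    and vert: "\<And>p. p \<in> A \<Longrightarrow> \<exists>c. lower A h c = {p}"
  shows "triangulation_of (insert {} (range (cell A h))) A"
proof -
  have ne: "A \<noteq> {}" using A by auto
  let ?T = "insert {} (range (cell A h))"
  have poly: "polygonal_subdivision (range (cell A h)) (convex hull A)"
    by (rule polygonal_subdivision_cells[OF A])
  have "(- 1) simplex ({} :: (real^2) set)" by simp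
  moreover have "int (card (lower A h c)) - 1 simplex cell A h c" for c
    unfolding cell_def using indep by (intro simplex_convex_hull) simp
  ultimately have simp: "\<exists>n. n simplex S" if "S \<in> ?T" for S using that by blast
  have face: "F \<in> ?T" if "S \<in> ?T" "F face_of S" for F S
    using that poly unfolding polygonal_subdivision_def by auto
  have int: "(S \<inter> S') face_of S" if "S \<in> ?T" "S' \<in> ?T" for S S'
    using that poly unfolding polygonal_subdivision_def by auto
  have "simplicial_complex ?T"
    unfolding simplicial_complex_def
  proof (intro conjI ballI allI impI)
    show "finite ?T" using finite_range_cell[OF A(1)] by simp
    show "F \<in> ?T" if "S \<in> ?T \<and> F face_of S" for F S using face that by blast
    show "(S \<inter> S') face_of S" if "S \<in> ?T \<and> S' \<in> ?T" for S S' using int that by blast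
  qed (rule simp)
  moreover have "\<Union>?T = convex hull A" using poly by (simp add: polygonal_subdivision_def)
  moreover have "{v. {v} \<in> ?T} = A"
  proof (intro subset_antisym subsetI)
    fix v assume "v \<in> {v. {v} \<in> ?T}"
    then obtain c where c: "{v} = cell A h c" by auto
    obtain p where p: "p \<in> lower A h c" using lower_nonempty[OF A(1) ne] by blast
    hence "p \<in> cell A h c" by (simp add: cell_def hull_inc)
    hence "p = v" unfolding c[symmetric] by simp
    thus "v \<in> A" using p by (simp add: lower_def)
  next
    fix v assume "v \<in> A"
    then obtain c where "lower A h c = {v}" using vert by blast
    hence "cell A h c = {v}" by (simp add: cell_def)
    thus "v \<in> {v. {v} \<in> ?T}" by (metis insertI2 mem_Collect_eq rangeI)
  qed
  ultimately show ?thesis by (simp add: triangulation_of_def)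
qed

lemma triangulation_of_triangle:
  fixes B :: "(real^2) set"
  assumes "card B = 3" "\<not> collinear B"
  shows "triangulation_of {F. F face_of convex hull B} B"
    and "triangles {F. F face_of convex hull B} = {convex hull B}"
    and "\<not> affine_dependent B"
proof -
  obtain x y z where "B = {x, y, z}" "x \<noteq> y" "y \<noteq> z" "x \<noteq> z"
    using assms(1) unfolding card_3_iff by blast
  thus indep: "\<not> affine_dependent B"
    using assms(2) collinear_3_eq_affine_dependent by blast
  have fin: "finite B" using assms(1) card.infinite by fastforce
  have B: "2 simplex convex hull B" using indep assms(1) by (intro simplex_convex_hull) simp
  have simp: "\<exists>n. n simplex F" if "F face_of convex hull B" for F
  proof -
    obtain C where C: "C \<subseteq> B" "F = convex hull C"
      using \<open>F face_of convex hull B\<close> unfolding face_of_convex_hull_affine_independent[OF indep]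
      by (elim exE conjE)
    have "int (card C) - 1 simplex convex hull C"
      using affine_independent_subset[OF indep C(1)] by (intro simplex_convex_hull) simp
    thus ?thesis unfolding C(2) by blast
  qed
  have "(F \<inter> G) face_of F" if "F face_of convex hull B" "G face_of convex hull B" for F G
    by (rule face_of_subset[OF face_of_Int[OF that] Int_lower1 face_of_imp_subset[OF that(1)]])
  hence "simplicial_complex {F. F face_of convex hull B}"
    unfolding simplicial_complex_def
  proof (intro conjI ballI allI impI)
    show "finite {F. F face_of convex hull B}"
      by (rule finite_polytope_faces[OF polytope_convex_hull[OF fin]])
    show "\<exists>n. n simplex S" if "S \<in> {F. F face_of convex hull B}" for S using simp that by blast
    show "F \<in> {F. F face_of convex hull B}"
      if "S \<in> {F. F face_of convex hull B} \<and> F face_of S" for F S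
      using that face_of_trans[of F S "convex hull B"] by blast
  qed blast
  moreover have "\<Union>{F. F face_of convex hull B} = convex hull B"
    using face_of_imp_subset[of _ "convex hull B"] face_of_refl[OF convex_convex_hull[of B]] by blast
  moreover have "{v. {v} face_of convex hull B} = B"
    by (simp add: face_of_singleton extreme_point_of_convex_hull_affine_independent[OF indep])
  ultimately show "triangulation_of {F. F face_of convex hull B} B"
    by (simp add: triangulation_of_def)
  have "F = convex hull B" if F: "F face_of convex hull B" "2 simplex F" for F
    using face_of_aff_dim_lt[OF convex_convex_hull F(1)] aff_dim_simplex[OF F(2)] aff_dim_simplex[OF B]
    by linarith
  thus "triangles {F. F face_of convex hull B} = {convex hull B}"
    using B face_of_refl[OF convex_convex_hull, of B] by (auto simp: triangles_def)
qed

lemma convex_hull_top_face: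
  assumes "finite B"
  shows "convex hull (top_face c B) face_of convex hull B"
proof (cases "B = {}")
  case False
  obtain p where p: "p \<in> top_face c B" using top_face_nonempty[OF assms False] by blast
  have le: "c \<bullet> x \<le> c \<bullet> p" if "x \<in> B" for x using p that by (simp add: top_face_def)
  have "{x \<in> B. c \<bullet> x = c \<bullet> p} = top_face c B"
    using p by (auto simp: top_face_def intro: antisym)
  thus ?thesis using face_of_convex_hull_supporting[OF assms refl le] by metis
qed (simp add: top_face_def)

text \<open>Only the second segment is orthogonal to \<open>u\<close>, so the two directions are
  independent.\<close>

lemma aff_dim_segment_plus_segment:
  fixes p q b b' u :: "real^2"
  assumes "b \<noteq> b'" "u \<bullet> b = u \<bullet> b'" "u \<bullet> p \<noteq> u \<bullet> q"
  shows "aff_dim (convex hull {p, q} + convex hull {b, b'}) = 2"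
proof -
  have "\<not> collinear ({p, q} + {b, b'})"
  proof
    assume "collinear ({p, q} + {b, b'})"
    then obtain w where w: "\<And>x y. \<lbrakk>x \<in> {p, q} + {b, b'}; y \<in> {p, q} + {b, b'}\<rbrakk> \<Longrightarrow> \<exists>c. x - y = c *\<^sub>R w"
      unfolding collinear_def by blast
    have mem: "p + b \<in> {p, q} + {b, b'}" "q + b \<in> {p, q} + {b, b'}" "p + b' \<in> {p, q} + {b, b'}"
      by (auto intro: set_plus_intro)
    obtain c where c: "p - q = c *\<^sub>R w" using w[OF mem(1,2)] by auto
    obtain d where d: "b - b' = d *\<^sub>R w" using w[OF mem(1,3)] by auto
    have "d \<noteq> 0" using d assms(1) by auto
    moreover have "d * (u \<bullet> w) = 0" using assms(2) arg_cong[OF d, of "\<lambda>x. u \<bullet> x"]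
      by (simp add: inner_diff_right)
    ultimately have "u \<bullet> w = 0" by simp
    hence "u \<bullet> (p - q) = 0" by (simp add: c)
    thus False using assms(3) by (simp add: inner_diff_right)
  qed
  thus ?thesis
    using aff_dim_le_DIM[of "{p, q} + {b, b'}"]
    by (simp add: collinear_aff_dim aff_dim_convex_hull flip: convex_hull_set_plus)
qed

section \<open>The mixed subdivision\<close>

text \<open>Bundles what \<open>exists_edge_directions\<close> provides about \<open>B\<close> with
  what \<open>generic_heights\<close> provides about \<open>A\<close>.\<close>

locale generic_lifting = three_directions N for N :: "(real^2) set" +
  fixes A B :: "(real^2) set" and h :: "real^2 \<Rightarrow> real" and a :: "real^2"
  assumes A: "finite A" "\<not> collinear A"
    and B: "card B = 3" "\<not> collinear B"
    and direction_cases: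
      "c \<noteq> 0 \<Longrightarrow> (\<exists>b. top_face c B = {b}) \<or> (\<exists>u\<in>N. \<exists>s>0. c = s *\<^sub>R u)"
    and top_edge: "\<lbrakk>u \<in> N; s > 0\<rbrakk> \<Longrightarrow> \<exists>b b'. b \<noteq> b' \<and> top_face (s *\<^sub>R u) B = {b, b'}"
    and a: "a \<in> A" "\<And>q. q \<in> A - {a} \<Longrightarrow> h a < h q"
    and h_vertex: "p \<in> A \<Longrightarrow> \<exists>c. \<forall>q\<in>A - {p}. h p - c \<bullet> p < h q - c \<bullet> q"
    and h_generic: "\<lbrakk>Y \<subseteq> A; affine_dependent Y\<rbrakk> \<Longrightarrow> \<not> affine_on Y h c"
    and h_inj: "inj_on h A"
    and h_direction: "\<lbrakk>u \<in> N; {p, q, r} \<subseteq> A; u \<bullet> p \<noteq> u \<bullet> q; u \<bullet> q \<noteq> u \<bullet> r; u \<bullet> p \<noteq> u \<bullet> r\<rbrakk>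
        \<Longrightarrow> \<not> affine_on {p, q, r} h (s *\<^sub>R u)"
begin

definition cellA :: "real^2 \<Rightarrow> (real^2) set" where "cellA = cell A h"
definition cellB :: "real^2 \<Rightarrow> (real^2) set" where "cellB c = convex hull (top_face c B)"
definition TA :: "(real^2) set set" where "TA = insert {} (range cellA)"
definition TB :: "(real^2) set set" where "TB = {F. F face_of convex hull B}"
definition M :: "((real^2) set \<times> (real^2) set) set" where "M = range (\<lambda>c. (cellA c, cellB c))"

lemma finite_B: "finite B" and B_ne: "B \<noteq> {}" and A_ne: "A \<noteq> {}"
  using B A card.infinite by fastforce+

lemma cellB_eq: "cellB = cell B (\<lambda>_. 0)"
  by (rule ext) (simp add: cellB_def cell_def lower_zero)

lemma indep_lower: "\<not> affine_dependent (lower A h c)"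
  using h_generic[OF lower_subset] affine_on_lower by blast

lemma indep_top: "\<not> affine_dependent (top_face c B)"
  using triangulation_of_triangle(3)[OF B] top_face_subset affine_independent_subset by blast

lemma lower_0: "lower A h 0 = {a}"
  using a by (force simp: lower_def)

lemma lower_vertex: "p \<in> A \<Longrightarrow> \<exists>c. lower A h c = {p}"
proof -
  assume p: "p \<in> A"
  then obtain c where c: "\<And>q. q \<in> A - {p} \<Longrightarrow> h p - c \<bullet> p < h q - c \<bullet> q" using h_vertex by blast
  have "lower A h c = {p}"
  proof (intro subset_antisym subsetI)
    fix q assume q: "q \<in> lower A h c"
    have "q \<notin> A - {p}" using lowerD[OF q p] c[of q] by linarith
    thus "q \<in> {p}" using q lower_subset by blast
  next
    fix q assume "q \<in> {p}"
    moreover have "h p - c \<bullet> p \<le> h q - c \<bullet> q" if "q \<in> A" for q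
      using c[of q] that by (cases "q = p") auto
    ultimately show "q \<in> lower A h c" using p by (simp add: lower_def)
  qed
  thus ?thesis by blast
qed

lemma lower_pair:
  assumes "u \<in> N" "p \<in> lower A h (s *\<^sub>R u)" "q \<in> lower A h (s *\<^sub>R u)" "p \<noteq> q"
  shows "u \<bullet> p \<noteq> u \<bullet> q" "lower A h (s *\<^sub>R u) = {p, q}"
  using lower_direction_subset_pair[OF h_inj h_direction[OF assms(1)] assms(2-4)] by blast+

lemma triangulation_TA: "triangulation_of TA A"
  unfolding TA_def cellA_def
  using triangulation_of_cells[OF A indep_lower lower_vertex] .

lemma triangulation_TB: "triangulation_of TB B"
  unfolding TB_def by (rule triangulation_of_triangle(1)[OF B])

lemma triangles_TB: "triangles TB = {convex hull B}"
  unfolding TB_def by (rule triangulation_of_triangle(2)[OF B])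

lemma simplex_cellA: "int (card (lower A h c)) - 1 simplex cellA c"
  unfolding cellA_def cell_def using indep_lower by (intro simplex_convex_hull) simp

lemma simplex_cellB: "int (card (top_face c B)) - 1 simplex cellB c"
  unfolding cellB_def using indep_top by (intro simplex_convex_hull) simp

lemma simplex_card_cellA: "n simplex cellA c \<Longrightarrow> int (card (lower A h c)) = n + 1"
  using aff_dim_simplex[of n "cellA c"] aff_dim_simplex[OF simplex_cellA, of c] by simp

lemma simplex_card_cellB: "n simplex cellB c \<Longrightarrow> int (card (top_face c B)) = n + 1"
  using aff_dim_simplex[of n "cellB c"] aff_dim_simplex[OF simplex_cellB, of c] by simp

text \<open>The strata of the normal fan of the triangle: origin, rays and open sectors, where the
  cell of \<open>B\<close> is the triangle, an edge and a vertex, respectively.\<close>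

lemma functional_cases:
  obtains (zero) "c = 0"
    | (ray) u s where "u \<in> N" "s > 0" "c = s *\<^sub>R u"
    | (vertex) b where "b \<in> B" "top_face c B = {b}" "cellB c = {b}"
proof (cases "c = 0")
  case False
  show thesis
  proof (cases "\<exists>u\<in>N. \<exists>s>0. c = s *\<^sub>R u")
    case False
    then obtain b where b: "top_face c B = {b}" using direction_cases[OF \<open>c \<noteq> 0\<close>] by blast
    moreover from b have "b \<in> B" using top_face_subset by blast
    ultimately show thesis by (intro vertex) (simp_all add: cellB_def)
  qed (use ray in blast)
qed (use zero in blast)

text \<open>By genericity no slope on a ray belongs to a triangle of \<open>A\<close>, so together
  with an edge of \<open>B\<close> the dimension stays at most two.\<close>

lemma card_lower_ray:
  assumes "u \<in> N"
  shows "card (lower A h (s *\<^sub>R u)) \<le> 2"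
proof (cases "\<exists>p q. p \<in> lower A h (s *\<^sub>R u) \<and> q \<in> lower A h (s *\<^sub>R u) \<and> p \<noteq> q")
  case True
  then obtain p q where "p \<in> lower A h (s *\<^sub>R u)" "q \<in> lower A h (s *\<^sub>R u)" "p \<noteq> q" by blast
  from lower_pair(2)[OF assms this] this(3) show ?thesis by simp
next
  case False
  hence "card (lower A h (s *\<^sub>R u)) \<le> Suc 0"
    using finite_lower[OF A(1)] by (simp add: card_le_Suc0_iff_eq)
  thus ?thesis by simp
qed

section \<open>The conditions on a mixed subdivision\<close>

lemma inj_M: "inj_on (\<lambda>(F, G). F + G) M"
proof (rule inj_onI)
  fix x y assume "x \<in> M" "y \<in> M" and eq: "(case x of (F, G) \<Rightarrow> F + G) = (case y of (F, G) \<Rightarrow> F + G)"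
  then obtain c c' where xy: "x = (cellA c, cellB c)" "y = (cellA c', cellB c')"
    unfolding M_def by blast
  have "cell A h c + cell B (\<lambda>_. 0) c = cell A h c' + cell B (\<lambda>_. 0) c'"
    using eq unfolding xy cellA_def cellB_eq by simp
  from cell_sum_inj[OF A(1) finite_B A_ne B_ne this]
  show "x = y" unfolding xy cellA_def cellB_eq cell_def by simp
qed

lemma polygonal_subdivision_M:
  "polygonal_subdivision ((\<lambda>(F, G). F + G) ` M) (convex hull (A + B))"
proof -
  have fin: "finite (A + B)" by (rule finite_set_plus[OF A(1) finite_B])
  obtain b where b: "b \<in> B" using B_ne by blast
  have "(+) b ` A \<subseteq> A + B"
    using b by (auto simp: add.commute intro: set_plus_intro)
  hence "aff_dim ((+) b ` A) \<le> aff_dim (A + B)" by (rule aff_dim_subset)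
  hence "\<not> collinear (A + B)" using A(2) by (simp add: collinear_aff_dim aff_dim_translation_eq)
  from polygonal_subdivision_cells[OF fin this, of "sum_height A B h (\<lambda>_. 0)"]
  have "polygonal_subdivision (range (\<lambda>c. cellA c + cellB c)) (convex hull (A + B))"
    unfolding cellA_def cellB_eq by (simp only: cell_sum_height[OF A(1) finite_B, of h "\<lambda>_. 0", symmetric])
  moreover have "(\<lambda>(F, G). F + G) ` M = range (\<lambda>c. cellA c + cellB c)"
    unfolding M_def by (simp add: image_image)
  ultimately show ?thesis by simp
qed

lemma aff_dim_plus_singleton: "aff_dim (F + {b}) = aff_dim F" "aff_dim ({b} + F) = aff_dim F"
  for F :: "(real^2) set"
proof -
  have "F + {b} = (+) b ` F" "{b} + F = (+) b ` F" by (auto simp: set_plus_def)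
  thus "aff_dim (F + {b}) = aff_dim F" "aff_dim ({b} + F) = aff_dim F"
    by (simp_all add: aff_dim_translation_eq)
qed

text \<open>Dimensions can fail to add up only if neither summand is a point. At slope zero the cell
  of \<open>A\<close> is \<open>{a}\<close>, in a sector that of \<open>B\<close> is a vertex, and
  on a ray the edge of \<open>B\<close> is orthogonal to \<open>u\<close> while an edge of
  \<open>A\<close> is not.\<close>

lemma aff_dim_cell_sum:
  "aff_dim (cellA c + cellB c) = (int (card (lower A h c)) - 1) + (int (card (top_face c B)) - 1)"
proof (cases c rule: functional_cases)
  case zero
  hence "cellA c = {a}" "card (lower A h c) = 1" by (simp_all add: cellA_def cell_def lower_0)
  thus ?thesis using aff_dim_simplex[OF simplex_cellB, of c] by (simp add: aff_dim_plus_singleton)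
next
  case (vertex b)
  thus ?thesis using aff_dim_simplex[OF simplex_cellA, of c] by (simp add: aff_dim_plus_singleton)
next
  case (ray u s)
  obtain b b' where b: "b \<noteq> b'" "top_face c B = {b, b'}" using top_edge ray by blast
  have "(s *\<^sub>R u) \<bullet> b = (s *\<^sub>R u) \<bullet> b'" using b ray top_face_eq[of b c B b'] by simp
  hence ub: "u \<bullet> b = u \<bullet> b'" using ray by simp
  show ?thesis
  proof (cases "\<exists>p. lower A h c = {p}")
    case True
    then obtain p where "lower A h c = {p}" by blast
    thus ?thesis using aff_dim_simplex[OF simplex_cellB, of c]
      by (simp add: aff_dim_plus_singleton cellA_def cell_def)
  next
    case False
    obtain p where p: "p \<in> lower A h c" using lower_nonempty[OF A(1) A_ne] by blast
    then obtain q where q: "q \<in> lower A h c" "p \<noteq> q" using False by blast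
    from lower_pair[OF ray(1), of p s q] p q ray(3)
    have pq: "u \<bullet> p \<noteq> u \<bullet> q" "lower A h c = {p, q}" by simp_all
    show ?thesis using aff_dim_segment_plus_segment[OF b(1) ub pq(1)] b q pq
      by (simp add: cellA_def cellB_def cell_def)
  qed
qed

lemma card_lower_triangle_imp:
  assumes "card (lower A h c) = 3"
  shows "\<exists>b\<in>B. cellB c = {b}"
proof (cases c rule: functional_cases)
  case zero
  thus ?thesis using assms by (simp add: lower_0)
next
  case (ray u s)
  thus ?thesis using assms card_lower_ray[OF ray(1), of s] by simp
qed blast

lemma cellB_triangle_imp:
  assumes "cellB c = convex hull B"
  shows "c = 0"
proof (cases c rule: functional_cases)
  case (ray u s)
  obtain b b' where b: "b \<noteq> b'" "top_face c B = {b, b'}" using top_edge ray by blast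
  have "2 simplex cellB c" unfolding assms
    using triangulation_of_triangle(3)[OF B] B(1) by (intro simplex_convex_hull) simp
  thus ?thesis using simplex_card_cellB b by fastforce
next
  case (vertex b)
  have "2 simplex cellB c" unfolding assms
    using triangulation_of_triangle(3)[OF B] B(1) by (intro simplex_convex_hull) simp
  thus ?thesis using simplex_card_cellB vertex by fastforce
qed

lemma unique_translate_of_triangle:
  assumes F: "F \<in> triangles TA"
  shows "\<exists>!b. b \<in> B \<and> (F, {b}) \<in> M"
proof -
  have "F \<noteq> {}" "2 simplex F" "F \<in> TA" using F by (auto simp: triangles_def)
  then obtain c where c: "F = cellA c" by (auto simp: TA_def)
  have "card (lower A h c) = 3" using simplex_card_cellA[of 2 c] \<open>2 simplex F\<close> c by simp
  then obtain b where b: "b \<in> B" "cellB c = {b}" using card_lower_triangle_imp by blast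
  show ?thesis
  proof (rule ex1I[of _ b])
    show "b \<in> B \<and> (F, {b}) \<in> M" using b c by (auto simp: M_def)
    fix b' assume "b' \<in> B \<and> (F, {b'}) \<in> M"
    then obtain c' where c': "cellA c' = F" "cellB c' = {b'}" by (auto simp: M_def)
    have L: "lower A h c = lower A h c'"
      by (rule cell_eq_imp_lower_eq[OF A(1) A_ne]) (use c c' in \<open>simp add: cellA_def\<close>)
    \<comment> \<open>Three affinely independent minimisers determine the slope, so \<open>F\<close>
      occurs for just one \<open>c\<close> and hence with one \<open>b\<close>.\<close>
    have "c = c'"
    proof (rule ccontr)
      assume "c \<noteq> c'"
      obtain p where p: "p \<in> lower A h c" using lower_nonempty[OF A(1) A_ne] by blast
      have "(c - c') \<bullet> q = (c - c') \<bullet> p" if q: "q \<in> lower A h c" for q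
        using lower_eq[OF p q] lower_eq[of p A h c' q] p q L by (simp add: inner_diff_left)
      hence "lower A h c \<subseteq> {x. (c - c') \<bullet> x = (c - c') \<bullet> p}" by blast
      from aff_dim_subset[OF this] have "aff_dim (lower A h c) \<le> 1"
        using \<open>c \<noteq> c'\<close> by (simp add: aff_dim_hyperplane)
      moreover have "int (card (lower A h c)) = aff_dim (lower A h c) + 1"
        by (rule aff_dim_affine_independent[OF indep_lower])
      ultimately show False using \<open>card (lower A h c) = 3\<close> by simp
    qed
    thus "b' = b" using b c' by simp
  qed
qed

text \<open>Only slope zero has the whole triangle as its cell of \<open>B\<close>, and
  \<open>a\<close> is the only minimiser there.\<close>

lemma unique_translate_of_B: "\<exists>!p. p \<in> A \<and> ({p}, convex hull B) \<in> M"
proof (rule ex1I[of _ a])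
  have 0: "cellA 0 = {a}" "cellB 0 = convex hull B"
    by (simp_all add: cellA_def cellB_def cell_def lower_0 top_face_0)
  hence "({a}, convex hull B) \<in> M" unfolding M_def by (intro range_eqI[of _ _ 0]) simp
  thus "a \<in> A \<and> ({a}, convex hull B) \<in> M" using a(1) by simp
  fix p assume "p \<in> A \<and> ({p}, convex hull B) \<in> M"
  then obtain c where c: "cellA c = {p}" "cellB c = convex hull B" unfolding M_def by blast
  have "{p} = {a}" using c(1) unfolding cellB_triangle_imp[OF c(2)] 0 by simp
  thus "p = a" by simp
qed

lemma mixed_subdivision_M: "mixed_subdivision A B TA TB M"
proof -
  have "F \<in> TA \<and> G \<in> TB \<and> (\<exists>i j. i simplex F \<and> j simplex G \<and> aff_dim (F + G) = i + j)"
    if FG: "(F, G) \<in> M" for F G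
  proof -
    obtain c where c: "F = cellA c" "G = cellB c" using FG by (auto simp: M_def)
    have "cellB c \<in> TB" unfolding TB_def cellB_def using convex_hull_top_face[OF finite_B] by blast
    moreover have "cellA c \<in> TA" by (simp add: TA_def)
    ultimately show ?thesis
      unfolding c using simplex_cellA[of c] simplex_cellB[of c] aff_dim_cell_sum[of c] by blast
  qed
  thus ?thesis
    unfolding mixed_subdivision_def triangles_TB
    using polygonal_subdivision_M inj_M unique_translate_of_triangle unique_translate_of_B
    by (intro conjI) auto
qed

text \<open>Each reached level \<open>t\<close> of \<open>u\<close> yields a slope on the ray of
  \<open>u\<close> where an edge of \<open>A\<close> with its upper end on level \<open>t\<close> is
  paired with an edge of \<open>B\<close>. The edge of \<open>B\<close> gives back \<open>u\<close>,
  and then the edge of \<open>A\<close> gives back \<open>t\<close>.\<close>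

lemma card_parallelograms_ge:
  "card (SIGMA u:N. reached A h a u) \<le> card (parallelograms M)"
proof -
  have "\<exists>s p q. s > 0 \<and> p \<in> lower A h (s *\<^sub>R fst x) \<and> q \<in> lower A h (s *\<^sub>R fst x) \<and>
      fst x \<bullet> p = snd x \<and> fst x \<bullet> q < snd x" if "x \<in> (SIGMA u:N. reached A h a u)" for x
    using reached_edge[where A=A and a=a and h=h and t="snd x" and u="fst x"] A(1) a that by auto
  then obtain s p q where spq: "\<And>x. x \<in> (SIGMA u:N. reached A h a u) \<Longrightarrow> s x > 0 \<and>
      p x \<in> lower A h (s x *\<^sub>R fst x) \<and> q x \<in> lower A h (s x *\<^sub>R fst x) \<and>
      fst x \<bullet> p x = snd x \<and> fst x \<bullet> q x < snd x"
    by metis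
  define \<phi> where "\<phi> x = (cellA (s x *\<^sub>R fst x), cellB (s x *\<^sub>R fst x))" for x
  have low: "lower A h (s x *\<^sub>R fst x) = {p x, q x}" "p x \<noteq> q x"
    if x: "x \<in> (SIGMA u:N. reached A h a u)" for x
  proof -
    show "p x \<noteq> q x" using spq[OF x] by auto
    have "fst x \<in> N" using x by auto
    thus "lower A h (s x *\<^sub>R fst x) = {p x, q x}"
      using lower_pair(2) spq[OF x] \<open>p x \<noteq> q x\<close> by blast
  qed
  have edge: "\<exists>b b'. b \<noteq> b' \<and> top_face (s x *\<^sub>R fst x) B = {b, b'} \<and> fst x \<bullet> b = fst x \<bullet> b'"
    if x: "x \<in> (SIGMA u:N. reached A h a u)" for x
  proof -
    have "fst x \<in> N" "s x > 0" using x spq[OF x] by auto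
    then obtain b b' where b: "b \<noteq> b'" "top_face (s x *\<^sub>R fst x) B = {b, b'}" using top_edge by blast
    have "(s x *\<^sub>R fst x) \<bullet> b = (s x *\<^sub>R fst x) \<bullet> b'"
      using b top_face_eq[of b "s x *\<^sub>R fst x" B b'] by simp
    thus ?thesis using b \<open>s x > 0\<close> by auto
  qed
  have "\<phi> x \<in> parallelograms M" if x: "x \<in> (SIGMA u:N. reached A h a u)" for x
  proof -
    have A2: "card (lower A h (s x *\<^sub>R fst x)) = 2" using low[OF x] by simp
    have B2: "card (top_face (s x *\<^sub>R fst x) B) = 2" using edge[OF x] by auto
    show ?thesis
      using simplex_cellA[of "s x *\<^sub>R fst x"] simplex_cellB[of "s x *\<^sub>R fst x"]
        aff_dim_cell_sum[of "s x *\<^sub>R fst x"] A2 B2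
      by (auto simp: parallelograms_def \<phi>_def M_def)
  qed
  hence "\<phi> ` (SIGMA u:N. reached A h a u) \<subseteq> parallelograms M" by blast
  moreover have "inj_on \<phi> (SIGMA u:N. reached A h a u)"
  proof (rule inj_onI)
    fix x y assume x: "x \<in> (SIGMA u:N. reached A h a u)" and y: "y \<in> (SIGMA u:N. reached A h a u)"
      and eq: "\<phi> x = \<phi> y"
    have LA: "lower A h (s x *\<^sub>R fst x) = lower A h (s y *\<^sub>R fst y)"
      by (rule cell_eq_imp_lower_eq[OF A(1) A_ne]) (use eq in \<open>simp add: \<phi>_def cellA_def\<close>)
    have "lower B (\<lambda>_. 0) (s x *\<^sub>R fst x) = lower B (\<lambda>_. 0) (s y *\<^sub>R fst y)"
      by (rule cell_eq_imp_lower_eq[OF finite_B B_ne]) (use eq in \<open>simp add: \<phi>_def cellB_eq\<close>)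
    hence LB: "top_face (s x *\<^sub>R fst x) B = top_face (s y *\<^sub>R fst y) B" by (simp add: lower_zero)
    obtain b b' where b: "b \<noteq> b'" "top_face (s x *\<^sub>R fst x) B = {b, b'}" "fst x \<bullet> b = fst x \<bullet> b'"
      using edge[OF x] by blast
    obtain d d' where d: "d \<noteq> d'" "top_face (s y *\<^sub>R fst y) B = {d, d'}" "fst y \<bullet> d = fst y \<bullet> d'"
      using edge[OF y] by blast
    \<comment> \<open>The common edge of \<open>B\<close> is orthogonal to both directions, which
      \<open>inner_inj\<close> permits only if they are equal.\<close>
    have "fst y \<bullet> b = fst y \<bullet> b'" using LB b(2) d by (auto simp: doubleton_eq_iff)
    moreover have "fst x \<in> N" "fst y \<in> N" using x y by auto
    ultimately have fst: "fst x = fst y" using inner_inj[of "fst x" "fst y" b b'] b by blast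
    have "{p x, q x} = {p y, q y}" using LA low[OF x] low[OF y] by simp
    hence "snd x = snd y"
      using spq[OF x] spq[OF y] fst by (auto simp: doubleton_eq_iff)
    thus "x = y" using fst by (simp add: prod_eq_iff)
  qed
  moreover have "finite (parallelograms M)"
  proof (rule finite_subset)
    show "parallelograms M \<subseteq> range cellA \<times> range cellB"
      by (auto simp: parallelograms_def M_def)
    show "finite (range cellA \<times> range cellB)"
      unfolding cellA_def cellB_eq using finite_range_cell A(1) finite_B by blast
  qed
  ultimately show ?thesis by (metis card_image card_mono)
qed

end

theorem theorem1p7:
  fixes A B :: "(real^2) set"
  assumes "finite A" and "\<not> collinear A"
    and "card B = 3" and "\<not> collinear B"
  shows "\<exists>TA TB M. triangulation_of TA A \<and> triangulation_of TB B \<and>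
           mixed_subdivision A B TA TB M \<and>
           real (card (parallelograms M)) \<ge>
             sqrt (real (card (triangles TA)) * real (card (triangles TB)))"
proof -
  obtain N where N: "three_directions N"
    and cases: "\<And>c. c \<noteq> 0 \<Longrightarrow> (\<exists>b. top_face c B = {b}) \<or> (\<exists>u\<in>N. \<exists>s>0. c = s *\<^sub>R u)"
    and edges: "\<And>u s. \<lbrakk>u \<in> N; s > 0\<rbrakk> \<Longrightarrow> \<exists>b b'. b \<noteq> b' \<and> top_face (s *\<^sub>R u) B = {b, b'}"
    by (rule exists_edge_directions[OF assms(3,4)]) blast
  interpret three_directions N by (rule N)
  have ne: "A \<noteq> {}" using assms(2) by auto
  have card2: "2 \<le> card A"
  proof (rule ccontr)
    assume "\<not> 2 \<le> card A"
    hence "card A \<le> Suc 0" by simp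
    obtain x where "x \<in> A" using ne by blast
    hence "A \<subseteq> {x}" using card_le_Suc0_iff_eq[OF assms(1)] \<open>card A \<le> Suc 0\<close> by blast
    thus False using assms(2) collinear_subset[of "{x}" A] by simp
  qed
  \<comment> \<open>Any direction will do: it shows that \<open>N\<close> is nonempty, so that a
    peeling of length \<open>depth N A\<close> exists.\<close>
  obtain u where u: "u \<in> N" using obtain_other by blast
  let ?K = "depth N A"
  obtain h a where h: "a \<in> A" "\<And>q. q \<in> A - {a} \<Longrightarrow> h a < h q"
    "\<And>p. p \<in> A \<Longrightarrow> \<exists>c. \<forall>q\<in>A - {p}. h p - c \<bullet> p < h q - c \<bullet> q"
    and K: "?K \<le> Suc (card (SIGMA u:N. reached A h a u))"
    and generic: "\<And>Y c. \<lbrakk>Y \<subseteq> A; affine_dependent Y\<rbrakk> \<Longrightarrow> \<not> affine_on Y h c" "inj_on h A"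
    "\<And>u p q r s. \<lbrakk>u \<in> N; {p, q, r} \<subseteq> A; u \<bullet> p \<noteq> u \<bullet> q; u \<bullet> q \<noteq> u \<bullet> r; u \<bullet> p \<noteq> u \<bullet> r\<rbrakk>
        \<Longrightarrow> \<not> affine_on {p, q, r} h (s *\<^sub>R u)"
    by (rule generic_heights[OF peel_depth[OF assms(1) u] assms(1) ne finite_N]) blast
  interpret generic_lifting N A B h a
    by unfold_locales (fact assms cases edges h generic)+
  have "0 \<notin> N"
  proof
    assume "0 \<in> N"
    then obtain b b' where "b \<noteq> b'" "B = {b, b'}" using edges[of 0 1] by (auto simp: top_face_0)
    thus False using assms(3) by simp
  qed
  have "card (triangles TA) + card (\<Union>u\<in>N. top_face u A) + 2 \<le> 2 * card A"
    by (rule card_triangles_le[OF triangulation_TA assms(1) card2 \<open>0 \<notin> N\<close>])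
  also have "\<dots> \<le> (?K - 1)\<^sup>2 + card (\<Union>u\<in>N. top_face u A) + 2"
    by (rule card_le_depth_boundary[OF assms(1) card2])
  finally have "card (triangles TA) \<le> (?K - 1)\<^sup>2" by simp
  also have "\<dots> \<le> (card (parallelograms M))\<^sup>2"
    using K card_parallelograms_ge by (intro power_mono) auto
  finally have "real (card (triangles TA)) \<le> (real (card (parallelograms M)))\<^sup>2"
    by (metis of_nat_le_iff of_nat_power)
  \<comment> \<open>\<open>TB\<close> has a single triangle, so the product under the root is the
    number of triangles of \<open>TA\<close>.\<close>
  hence "sqrt (real (card (triangles TA)) * real (card (triangles TB))) \<le> real (card (parallelograms M))"
    unfolding triangles_TB by (intro real_le_lsqrt) auto
  thus ?thesis using triangulation_TA triangulation_TB mixed_subdivision_M by blast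
qed

end
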